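(* There is an absolute constant $c>0$ such that for every $\ell\ge 2$ and every weight vector $w\in(0,\infty)^\ell$ there is an online algorithm for the convex allocation problem in dimension $\ell$ with weights $w$ that is $c\log(\ell+1)$-competitive.
   Context: Allocation problem in dimension $\ell$ with weights $w=(w_1,\dots,w_\ell)\in(0,\infty)^\ell$: an algorithm maintains a point $x(t)$ in the simplex $\Delta^{\ell-1}=\{x\in[0,1]^\ell:\sum_{i=1}^\ell x_i=1\}$, starting from a given $x(0)$. At each time $t=1,2,\dots$ an adversary reveals a direction $r_t\in\{1,\dots,\ell\}$ and a non-increasing cost function $f_t:[0,1]\to\mathbb{R}_{\ge0}\cup\{\infty\}$; the algorithm then chooses $x(t)\in\Delta^{\ell-1}$ (an online algorithm chooses it knowing only the data revealed up to time $t$), paying movement cost $\sum_{i=1}^\ell w_i|x_i(t)-x_i(t-1)|$ and service cost $f_t(x_{r_t}(t))$. The goal is to minimize total cost. In the convex allocation problem every $f_t$ is additionally convex. An online algorithm is $\rho$-competitive if there is $b$ independent of the request sequence such that on every sequence its total cost is at most $\rho\cdot\mathrm{OPT}+b$, where $\mathrm{OPT}$ is the minimum total cost of any offline sequence of points serving the same sequence from the same starting point. *)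

theory Defs
  imports Complex_Main "HOL-Library.Extended_Real"
begin

text \<open>Directions are indexed by 0,...,l-1 (instead of 1,...,l). Points are
  functions nat => real; only coordinates i < l matter.\<close>

definition simplex :: "nat \<Rightarrow> (nat \<Rightarrow> real) set" where
  "simplex l = {x. (\<forall>i<l. 0 \<le> x i \<and> x i \<le> 1) \<and> (\<Sum>i<l. x i) = 1}"

definition convex_cost :: "(real \<Rightarrow> ereal) \<Rightarrow> bool" where
  "convex_cost f \<longleftrightarrow>
     (\<forall>x\<in>{0..1}. 0 \<le> f x) \<and>
     (\<forall>x y. 0 \<le> x \<longrightarrow> x \<le> y \<longrightarrow> y \<le> 1 \<longrightarrow> f y \<le> f x) \<and>
     (\<forall>a\<in>{0..1}. \<forall>b\<in>{0..1}. \<forall>u. 0 < u \<longrightarrow> u < 1 \<longrightarrow>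
        f (u * a + (1 - u) * b) \<le> ereal u * f a + ereal (1 - u) * f b)"

type_synonym request = "nat \<times> (real \<Rightarrow> ereal)"

definition valid_request :: "nat \<Rightarrow> request \<Rightarrow> bool" where
  "valid_request l q \<longleftrightarrow> fst q < l \<and> convex_cost (snd q)"

definition move_cost :: "nat \<Rightarrow> (nat \<Rightarrow> real) \<Rightarrow> (nat \<Rightarrow> real) \<Rightarrow> (nat \<Rightarrow> real) \<Rightarrow> real" where
  "move_cost l w x y = (\<Sum>i<l. w i * \<bar>y i - x i\<bar>)"

text \<open>Total cost of a trajectory X (X 0 is the start, X (t+1) serves request t).\<close>
definition total_cost :: "nat \<Rightarrow> (nat \<Rightarrow> real) \<Rightarrow> request list \<Rightarrow> (nat \<Rightarrow> nat \<Rightarrow> real) \<Rightarrow> ereal" where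
  "total_cost l w qs X =
     (\<Sum>t<length qs. ereal (move_cost l w (X t) (X (Suc t))) + snd (qs ! t) (X (Suc t) (fst (qs ! t))))"

definition OPT :: "nat \<Rightarrow> (nat \<Rightarrow> real) \<Rightarrow> (nat \<Rightarrow> real) \<Rightarrow> request list \<Rightarrow> ereal" where
  "OPT l w x0 qs = (INF X \<in> {X. X 0 = x0 \<and> (\<forall>t\<in>{1..length qs}. X t \<in> simplex l)}. total_cost l w qs X)"

text \<open>An online algorithm maps the nonempty prefix of requests revealed so far to the
  current point; onlineness is built into this type.\<close>
definition online_alg :: "nat \<Rightarrow> (request list \<Rightarrow> (nat \<Rightarrow> real)) \<Rightarrow> bool" where
  "online_alg l A \<longleftrightarrow> (\<forall>qs. qs \<noteq> [] \<longrightarrow> list_all (valid_request l) qs \<longrightarrow> A qs \<in> simplex l)"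

definition alg_traj :: "(nat \<Rightarrow> real) \<Rightarrow> (request list \<Rightarrow> (nat \<Rightarrow> real)) \<Rightarrow> request list \<Rightarrow> nat \<Rightarrow> nat \<Rightarrow> real" where
  "alg_traj x0 A qs t = (if t = 0 then x0 else A (take t qs))"

end

(* Besides the point x, the algorithm keeps a reference point rho_i >= x_i for each coordinate. Write
y_i = rho_i - x_i and a_i = max 0 (rho_i - z_i), where z is the comparator. For a request whose
supporting line at x_r is c (s - u), h = s - x_r, mass is evicted from each other coordinate in the
support of x at rate (y_i + e/l) / w_i, where e = sum y_i + h. If z_r is at least x_r + h/2, then
feasibility of z forces sum a_i >= e/2, and the potential sum w_i a_i ln ((a_i + y_i) / (y_i + a_i/l))
drops by a constant fraction of the eviction cost; otherwise z itself pays at least half of the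
service cost. The noise e/l scales with the current uncertainty e, so the potential is Lipschitz in z
with constant O(log l) w_i at all scales. A request is served in finitely many small steps of
this kind, after replacing its cost by a Lipschitz minorant; the replacement costs an additive error
that is summable over the requests. *)

theory Submission
  imports Defs
begin

text \<open>The term a/l inside the logarithm mirrors the noise e/l in the eviction rate. The
  derivative of \<open>phi\<close> in y is -(1 - 1/l) a^2 / ((a + y) (y + a/l)); times the rate y +
  e/l it becomes, for a at most e, a drop of order at least a^2 / (a + y), with no logarithm lost.
  Since \<open>phi\<close> contains no absolute scale, it is homogeneous of degree one in (a, y).
  This is what makes the reference point of the requested coordinate controllable: when x_r rises,
  rho_r can be lowered so that y_r shrinks by a factor and, for a comparator well above x_r, a_r
  shrinks at least as much. Two linear terms pay for what \<open>phi\<close> cannot see: (z - rho)^+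
  falls when rho is pushed up, and rho - x falls when rho is pulled down. A request cost may be
  infinite or arbitrarily steep, so no fixed step size suits the cost itself. The Lipschitz constant
  of the minorant is therefore chosen separately for every request, from the current potential, and
  the remaining gap is closed by one tiny extra move.\<close>

section \<open>The scale-free logarithmic function and its monotonicity estimates\<close>

definition phi :: "nat \<Rightarrow> real \<Rightarrow> real \<Rightarrow> real" where
  "phi l a y = a * ln ((a + y) / (y + a / real l))"

lemma phi_zero [simp]: "phi l 0 y = 0"
  by (simp add: phi_def)

lemma phi_ratio_bounds:
  assumes "1 \<le> l" "0 < a" "0 \<le> y"
  shows "1 \<le> (a + y) / (y + a / real l)" "(a + y) / (y + a / real l) \<le> real l"
proof -
  have pos: "0 < y + a / real l" using assms by (simp add: add_nonneg_pos)
  have "a / real l \<le> a / 1" using assms by (intro divide_left_mono) auto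
  then show "1 \<le> (a + y) / (y + a / real l)" using pos by (simp add: pos_le_divide_eq)
  have "real l * (y + a / real l) = real l * y + a" using assms by (simp add: field_simps)
  moreover have "1 * y \<le> real l * y" using assms by (intro mult_right_mono) auto
  ultimately show "(a + y) / (y + a / real l) \<le> real l"
    using pos by (simp add: pos_divide_le_eq)
qed

lemma phi_nonneg:
  assumes "1 \<le> l" "0 \<le> a" "0 \<le> y"
  shows "0 \<le> phi l a y"
proof (cases "a = 0")
  case False
  then show ?thesis using phi_ratio_bounds(1)[of l a y] assms by (simp add: phi_def)
qed simp

text \<open>With R the ratio inside the logarithm, the increment splits into (a' - a) ln R', where
  R' is at most l, and a (ln R' - ln R), which ln x \<le> x - 1 bounds by a' - a. These are the
  summands ln l and 1 of the Lipschitz constant.\<close>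

lemma phi_Lipschitz:
  assumes "1 \<le> l" "0 \<le> a" "a \<le> a'" "0 \<le> y"
  shows "phi l a y \<le> phi l a' y" "phi l a' y \<le> phi l a y + (ln (real l) + 1) * (a' - a)"
proof -
  have lnl: "0 \<le> ln (real l)" using assms by simp
  have "phi l a y \<le> phi l a' y \<and> phi l a' y \<le> phi l a y + (ln (real l) + 1) * (a' - a)"
  proof (cases "a = 0")
    case True
    have "phi l a' y \<le> (ln (real l) + 1) * a'"
    proof (cases "a' = 0")
      case False
      then have "0 < a'" using True assms by simp
      then have "ln ((a' + y) / (y + a' / real l)) \<le> ln (real l)"
        using phi_ratio_bounds[of l a' y] assms by (subst ln_le_cancel_iff) auto
      then have "phi l a' y \<le> a' * ln (real l)"
        using \<open>0 < a'\<close> unfolding phi_def by (intro mult_left_mono) auto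
      then show ?thesis using \<open>0 < a'\<close> by (simp add: algebra_simps)
    qed simp
    then show ?thesis using True phi_nonneg[of l a' y] assms by simp
  next
    case False
    then have a: "0 < a" "0 < a'" using assms by auto
    define R R' where "R = (a + y) / (y + a / real l)" and "R' = (a' + y) / (y + a' / real l)"
    have R: "1 \<le> R" and R': "1 \<le> R'" "R' \<le> real l"
      using phi_ratio_bounds[of l a y] phi_ratio_bounds[of l a' y] a assms by (auto simp: R_def R'_def)
    have pos: "0 < y + a / real l" "0 < y + a' / real l" "0 < a + y" using a assms by (auto simp: add_nonneg_pos)
    have quot: "R' / R - 1 = (a' - a) * (y - y / real l) / ((y + a' / real l) * (a + y))"
    proof -
      have "R' / R - 1 = ((a' + y) * (y + a / real l) - (a + y) * (y + a' / real l)) / ((y + a' / real l) * (a + y))"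
        unfolding R_def R'_def using pos by (simp add: diff_divide_distrib)
      also have "(a' + y) * (y + a / real l) - (a + y) * (y + a' / real l) = (a' - a) * (y - y / real l)"
        by (simp add: algebra_simps add_divide_distrib diff_divide_distrib)
      finally show ?thesis .
    qed
    have yl: "0 \<le> y / real l" "y / real l \<le> y"
      using assms divide_left_mono[of 1 "real l" y] by auto
    have "0 \<le> R' / R - 1" unfolding quot using pos assms yl by (intro divide_nonneg_nonneg mult_nonneg_nonneg) auto
    then have "R \<le> R'" using R by (simp add: divide_simps split: if_splits)
    then have lnR: "ln R \<le> ln R'" "0 \<le> ln R" using R R' by auto
    have up: "a * (ln R' - ln R) \<le> a' - a"
    proof -
      have "ln R' - ln R = ln (R' / R)" using R R' by (simp add: ln_div)
      also have "\<dots> \<le> R' / R - 1" using R R' by (intro ln_le_minus_one) simp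
      also have "\<dots> \<le> (a' - a) / (a + y)"
      proof -
        have "y - y / real l \<le> y + a' / real l" using yl a assms by (smt (verit) divide_nonneg_nonneg of_nat_0_le_iff)
        then have "(a' - a) * (y - y / real l) \<le> (a' - a) * (y + a' / real l)"
          using assms by (intro mult_left_mono) auto
        then have "(a' - a) * (y - y / real l) / ((y + a' / real l) * (a + y)) \<le> (a' - a) * (y + a' / real l) / ((y + a' / real l) * (a + y))"
          using pos by (intro divide_right_mono) auto
        then show ?thesis unfolding quot using pos by simp
      qed
      finally have "a * (ln R' - ln R) \<le> a * ((a' - a) / (a + y))" using a by (intro mult_left_mono) auto
      also have "\<dots> = (a' - a) * (a / (a + y))" by simp
      also have "\<dots> \<le> (a' - a) * 1" using a assms by (intro mult_left_mono) auto
      finally show ?thesis by simp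
    qed
    have low: "a * ln R \<le> a' * ln R'" using lnR a assms by (intro mult_mono) auto
    have "ln R' \<le> ln (real l)" using R' by simp
    then have "(a' - a) * ln R' \<le> (a' - a) * ln (real l)" using assms by (intro mult_left_mono) auto
    moreover have "a' * ln R' = a * ln R + (a' - a) * ln R' + a * (ln R' - ln R)" by (simp add: algebra_simps)
    ultimately have "a' * ln R' \<le> a * ln R + (a' - a) * ln (real l) + (a' - a)" using up by linarith
    then show ?thesis using low unfolding phi_def R_def[symmetric] R'_def[symmetric] by (simp add: algebra_simps)
  qed
  then show "phi l a y \<le> phi l a' y" "phi l a' y \<le> phi l a y + (ln (real l) + 1) * (a' - a)" by auto
qed

lemma phi_scale:
  assumes "0 \<le> t"
  shows "phi l (t * a) (t * y) = t * phi l a y"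
proof (cases "t = 0")
  case False
  have "(t * a + t * y) / (t * y + t * a / real l) = (t * (a + y)) / (t * (y + a / real l))"
    by (simp add: algebra_simps)
  also have "\<dots> = (a + y) / (y + a / real l)" using False by simp
  finally show ?thesis by (simp add: phi_def)
qed simp

text \<open>A finite-difference form of the derivative in y, obtained from ln x \<le> x - 1 at the
  quotient of the two ratios. The price of a positive step is the extra D in one factor of the
  denominator.\<close>

lemma phi_decrease:
  assumes "1 \<le> l" "0 \<le> a" "0 \<le> y" "0 \<le> D"
  shows "D * a\<^sup>2 * (1 - 1 / real l) / ((a + y) * (y + D + a / real l)) \<le> phi l a y - phi l a (y + D)"
proof (cases "a = 0")
  case False
  then have a: "0 < a" using assms by simp
  define R R' where "R = (a + y) / (y + a / real l)" and "R' = (a + (y + D)) / (y + D + a / real l)"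
  have R: "1 \<le> R" "1 \<le> R'"
    using phi_ratio_bounds[of l a y] phi_ratio_bounds[of l a "y + D"] a assms by (auto simp: R_def R'_def)
  have pos: "0 < y + a / real l" "0 < y + D + a / real l" "0 < a + y" "0 < a + (y + D)"
    using a assms by (auto simp: add_nonneg_pos)
  have "1 - R' / R = ((a + y) * (y + D + a / real l) - (a + (y + D)) * (y + a / real l)) / ((a + y) * (y + D + a / real l))"
    unfolding R_def R'_def using pos by (simp add: diff_divide_distrib)
  also have "(a + y) * (y + D + a / real l) - (a + (y + D)) * (y + a / real l) = D * a * (1 - 1 / real l)"
    by (simp add: algebra_simps)
  finally have q: "1 - R' / R = D * a * (1 - 1 / real l) / ((a + y) * (y + D + a / real l))" .
  have "ln (R' / R) \<le> R' / R - 1" using R by (intro ln_le_minus_one) simp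
  then have "1 - R' / R \<le> ln R - ln R'" using R by (simp add: ln_div)
  then have "a * (1 - R' / R) \<le> a * (ln R - ln R')" using a by (intro mult_left_mono) auto
  then show ?thesis unfolding q phi_def R_def[symmetric] R'_def[symmetric]
    by (simp add: algebra_simps power2_eq_square)
qed simp

lemma phi_decreasing:
  assumes "1 \<le> l" "0 \<le> a" "0 \<le> y" "0 \<le> D"
  shows "phi l a (y + D) \<le> phi l a y"
proof -
  have "0 \<le> D * a\<^sup>2 * (1 - 1 / real l) / ((a + y) * (y + D + a / real l))"
    using assms by (intro divide_nonneg_nonneg mult_nonneg_nonneg) auto
  then show ?thesis using phi_decrease[OF assms] by linarith
qed

text \<open>The lower bound is linear in y and in the truncated gap, so it can be added over
  coordinates knowing only the two sums. The gap is cut at e because the noise e/l dominates a/l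
  only up to that scale.\<close>

lemma phi_decrease_proportional:
  assumes "2 \<le> l" "0 \<le> a" "0 \<le> y" "0 < e" "0 \<le> D" "D \<le> e / real l"
    and D: "w * D = t * (y + e / real l)" and "0 < w" "0 \<le> t"
  shows "t / 4 * (7 / 16 * min a e - y / 16) \<le> w * (phi l a y - phi l a (y + D))"
proof (cases "a = 0")
  case True
  then show ?thesis using assms by (simp add: mult_nonneg_nonneg)
next
  case False
  then have a: "0 < a" using assms by simp
  define b where "b = min a e"
  have b: "0 < b" "b \<le> a" "b \<le> e" using a assms by (auto simp: b_def)
  have l: "0 < real l" "1 / real l \<le> 1 / 2" using assms by (auto simp: field_simps)
  \<comment> \<open>The right side is convex in y; the left side is its tangent at y = 3b, with
    value b/4 and slope -1/16.\<close>
  have s1: "7 / 16 * b - y / 16 \<le> b * (b / (b + y))"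
  proof -
    have "0 \<le> (3 * b - y)\<^sup>2" by simp
    then have "(7 / 16 * b - y / 16) * (b + y) \<le> b * b" by (simp add: power2_eq_square field_simps)
    then show ?thesis using b assms by (simp add: pos_le_divide_eq)
  qed
  have s2: "b / (b + y) \<le> a / (a + y)"
    using a b assms by (simp add: divide_simps algebra_simps)
       (smt (verit) mult_right_mono)
  have s3: "b / 2 \<le> a * e / (e + a)"
  proof (cases "a \<le> e")
    case True
    then have "b = a" by (simp add: b_def)
    have "a * (e + a) \<le> a * (2 * e)" using True a by (intro mult_left_mono) auto
    then show ?thesis using \<open>b = a\<close> a assms by (simp add: field_simps)
  next
    case False
    then have "b = e" by (simp add: b_def)
    have "e * (e + a) \<le> e * (2 * a)" using False assms by (intro mult_left_mono) auto
    then show ?thesis using \<open>b = e\<close> a assms by (simp add: field_simps)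
  qed
  \<comment> \<open>The bound D \<le> e/l absorbs the discretisation term D of the
    denominator.\<close>
  have s4: "e / (e + a) \<le> (y + e / real l) / (y + D + a / real l)"
  proof -
    have p: "0 < y + D + a / real l" using a l assms by (simp add: add_nonneg_pos)
    have "e * (y + D + a / real l) \<le> (y + e / real l) * (e + a)"
    proof -
      have "e * D \<le> e * (e / real l)" using assms by (intro mult_left_mono) auto
      moreover have "0 \<le> y * a" using assms by simp
      ultimately show ?thesis by (simp add: algebra_simps add_divide_distrib)
    qed
    then show ?thesis using p a assms by (simp add: divide_simps)
  qed
  have pos: "0 < a + y" "0 < y + D + a / real l" using a l assms by (auto simp: add_nonneg_pos)
  have "t / 4 * (7 / 16 * b - y / 16) \<le> t / 4 * (b * (b / (b + y)))"
    using s1 assms by (intro mult_left_mono) auto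
  also have "\<dots> = t / 2 * ((b / (b + y)) * (b / 2))" by simp
  also have "\<dots> \<le> t / 2 * ((a / (a + y)) * (a * e / (e + a)))"
    using s2 s3 a b assms by (intro mult_left_mono mult_mono) auto
  also have "\<dots> = t / 2 * ((a / (a + y)) * a * (e / (e + a)))" by simp
  also have "\<dots> \<le> t / 2 * ((a / (a + y)) * a * ((y + e / real l) / (y + D + a / real l)))"
    using s4 a assms by (intro mult_left_mono) auto
  also have "\<dots> = (t * (y + e / real l)) * a\<^sup>2 * (1 / 2) / ((a + y) * (y + D + a / real l))"
    by (simp add: power2_eq_square)
  also have "\<dots> = w * (D * a\<^sup>2 * (1 / 2) / ((a + y) * (y + D + a / real l)))"
    unfolding D[symmetric] by simp
  also have "\<dots> \<le> w * (D * a\<^sup>2 * (1 - 1 / real l) / ((a + y) * (y + D + a / real l)))"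
    using l pos assms by (intro mult_left_mono divide_right_mono) auto
  also have "\<dots> \<le> w * (phi l a y - phi l a (y + D))"
    using phi_decrease[of l a y D] assms by (intro mult_left_mono) auto
  finally show ?thesis by (simp add: b_def)
qed

section \<open>The potential of one coordinate\<close>

text \<open>The weight 8 exceeds 4 so that lowering \<rho> pays for the growth of the middle term.
  Eviction raises the last term, and 512 is large enough for the drop of \<open>phi\<close> to
  outweigh that rise as well as the movement.\<close>

definition coord_pot :: "nat \<Rightarrow> real \<Rightarrow> real \<Rightarrow> real \<Rightarrow> real" where
  "coord_pot l z v \<rho> = 512 * phi l (max 0 (\<rho> - z)) (\<rho> - v) + 4 * max 0 (z - \<rho>) + 8 * (\<rho> - v)"

lemma coord_pot_nonneg: "1 \<le> l \<Longrightarrow> v \<le> \<rho> \<Longrightarrow> 0 \<le> coord_pot l z v \<rho>"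
  unfolding coord_pot_def using phi_nonneg[of l "max 0 (\<rho> - z)" "\<rho> - v"] by simp

lemma coord_pot_Lipschitz:
  assumes "1 \<le> l" "v \<le> \<rho>"
  shows "coord_pot l z' v \<rho> \<le> coord_pot l z v \<rho> + 516 * (ln (real l) + 1) * \<bar>z' - z\<bar>"
proof -
  have lnl: "0 \<le> ln (real l)" using assms by simp
  have 1: "phi l (max 0 (\<rho> - z')) (\<rho> - v) \<le> phi l (max 0 (\<rho> - z)) (\<rho> - v) + (ln (real l) + 1) * \<bar>z' - z\<bar>"
  proof (cases "max 0 (\<rho> - z') \<le> max 0 (\<rho> - z)")
    case True
    then show ?thesis using phi_Lipschitz(1)[of l "max 0 (\<rho> - z')" "max 0 (\<rho> - z)" "\<rho> - v"] assms lnl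
      by (smt (verit) mult_nonneg_nonneg)
  next
    case False
    have "(ln (real l) + 1) * (max 0 (\<rho> - z') - max 0 (\<rho> - z)) \<le> (ln (real l) + 1) * \<bar>z' - z\<bar>"
      using lnl by (intro mult_left_mono) auto
    then show ?thesis using False phi_Lipschitz(2)[of l "max 0 (\<rho> - z)" "max 0 (\<rho> - z')" "\<rho> - v"] assms by linarith
  qed
  have "1 * \<bar>z' - z\<bar> \<le> (ln (real l) + 1) * \<bar>z' - z\<bar>" using lnl by (intro mult_right_mono) auto
  moreover have "max 0 (z' - \<rho>) \<le> max 0 (z - \<rho>) + \<bar>z' - z\<bar>" by simp
  moreover have "516 * (ln (real l) + 1) * \<bar>z' - z\<bar> = 516 * ((ln (real l) + 1) * \<bar>z' - z\<bar>)" by simp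
  ultimately show ?thesis using 1 unfolding coord_pot_def by linarith
qed

lemma coord_pot_shift:
  assumes "1 \<le> l" "v \<le> \<rho>" "0 \<le> D"
  shows "coord_pot l z (v + D) (\<rho> + D) \<le> coord_pot l z v \<rho> + 512 * (ln (real l) + 1) * D"
proof -
  have lnl: "0 \<le> ln (real l)" using assms by simp
  have "phi l (max 0 (\<rho> + D - z)) (\<rho> - v) \<le> phi l (max 0 (\<rho> - z)) (\<rho> - v) + (ln (real l) + 1) * (max 0 (\<rho> + D - z) - max 0 (\<rho> - z))"
    using assms by (intro phi_Lipschitz(2)) auto
  moreover have "(ln (real l) + 1) * (max 0 (\<rho> + D - z) - max 0 (\<rho> - z)) \<le> (ln (real l) + 1) * D"
    using lnl assms by (intro mult_left_mono) auto
  moreover have "max 0 (z - (\<rho> + D)) \<le> max 0 (z - \<rho>)" using assms by auto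
  moreover have "512 * (ln (real l) + 1) * D = 512 * ((ln (real l) + 1) * D)" by simp
  moreover have y: "\<rho> + D - (v + D) = \<rho> - v" by simp
  ultimately show ?thesis unfolding coord_pot_def y by linarith
qed

text \<open>By homogeneity, contracting a and y by the common factor y'/y cannot raise
  \<open>phi\<close>; only the excess of a' over the contracted gap is charged, at the Lipschitz
  rate.\<close>

lemma phi_shrink:
  assumes "1 \<le> l" "0 < y" "0 \<le> a" "0 \<le> y'" "y' \<le> y" "0 \<le> a'" "0 \<le> X" "a' - a * (y' / y) \<le> X"
  shows "phi l a' y' \<le> phi l a y + (ln (real l) + 1) * X"
proof -
  have lnl: "0 \<le> ln (real l)" using assms by simp
  define t where "t = y' / y"
  have t: "0 \<le> t" "t \<le> 1" "y' = t * y" using assms by (auto simp: t_def)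
  have base: "phi l (a * t) y' \<le> phi l a y"
  proof -
    have "phi l (a * t) y' = t * phi l a y" using phi_scale[OF t(1), of l a y] t(3) by (simp add: mult.commute)
    also have "\<dots> \<le> 1 * phi l a y" using phi_nonneg[of l a y] t assms by (intro mult_right_mono) auto
    finally show ?thesis by simp
  qed
  have at: "0 \<le> a * t" using t assms by simp
  show ?thesis
  proof (cases "a' \<le> a * t")
    case True
    then have "phi l a' y' \<le> phi l (a * t) y'" using assms by (intro phi_Lipschitz(1)) auto
    moreover have "0 \<le> (ln (real l) + 1) * X" using lnl assms by simp
    ultimately show ?thesis using base by linarith
  next
    case False
    have "phi l a' y' \<le> phi l (a * t) y' + (ln (real l) + 1) * (a' - a * t)"
      using False assms at by (intro phi_Lipschitz(2)) auto
    moreover have "(ln (real l) + 1) * (a' - a * t) \<le> (ln (real l) + 1) * X"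
      using lnl assms by (intro mult_left_mono) (auto simp: t_def)
    ultimately show ?thesis using base by linarith
  qed
qed

text \<open>The reference point is pushed up together with \<open>v\<close> if it is close to \<open>v\<close>, and pulled
  down faster than \<open>v\<close> rises otherwise. In the first case of the conclusion the comparator \<open>z\<close>
  already serves most of the request; in the second one it pays for it.\<close>

lemma coord_pot_load:
  assumes l: "1 \<le> l" and v: "v \<le> \<rho>" and h: "0 < h" and \<eta>: "0 \<le> \<eta>" "\<eta> \<le> h / 8"
  obtains \<rho>' where "v + \<eta> \<le> \<rho>'"
    and "\<And>z. v + h / 2 \<le> z \<Longrightarrow> coord_pot l z (v + \<eta>) \<rho>' \<le> coord_pot l z v \<rho> - 4 * \<eta>"
    and "\<And>z. z < v + h / 2 \<Longrightarrow> coord_pot l z (v + \<eta>) \<rho>' \<le> coord_pot l z v \<rho>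
           + 512 * (ln (real l) + 1) * (\<eta> + 6 * max 0 (v - z) * \<eta> / h)"
proof (cases "\<rho> - v \<le> h / 4")
  case True
  have lnl: "0 \<le> ln (real l)" using l by simp
  show ?thesis
  proof (rule that[of "\<rho> + \<eta>"])
    show "v + \<eta> \<le> \<rho> + \<eta>" using v by simp
    fix z
    show "coord_pot l z (v + \<eta>) (\<rho> + \<eta>) \<le> coord_pot l z v \<rho> - 4 * \<eta>" if "v + h / 2 \<le> z"
    proof -
      have "\<rho> + \<eta> \<le> z" using that True \<eta> h by simp
      then show ?thesis using \<eta> unfolding coord_pot_def by simp
    qed
    have "0 \<le> 512 * (ln (real l) + 1) * (6 * max 0 (v - z) * \<eta> / h)" using lnl h \<eta> by simp
    moreover have "512 * (ln (real l) + 1) * (\<eta> + 6 * max 0 (v - z) * \<eta> / h) =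
       512 * (ln (real l) + 1) * \<eta> + 512 * (ln (real l) + 1) * (6 * max 0 (v - z) * \<eta> / h)"
      by (rule distrib_left)
    ultimately show "coord_pot l z (v + \<eta>) (\<rho> + \<eta>) \<le> coord_pot l z v \<rho>
           + 512 * (ln (real l) + 1) * (\<eta> + 6 * max 0 (v - z) * \<eta> / h)"
      using coord_pot_shift[OF l v \<eta>(1), of z] by linarith
  qed
next
  case False
  define y where "y = \<rho> - v"
  \<comment> \<open>Chosen so that (h/2) k = y \<eta>: for z at least v + h/2 the gap then contracts
    at least as fast as y, and the excess X can be taken to be 0.\<close>
  define k where "k = 2 * y * \<eta> / h"
  have y: "h / 4 < y" "0 < y" using False h by (auto simp: y_def)
  have k0: "0 \<le> k" using y \<eta> h by (simp add: k_def)
  have "k \<le> y / 4"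
  proof -
    have "y * \<eta> \<le> y * (h / 8)" using y \<eta> by (intro mult_left_mono) auto
    then show ?thesis using h by (simp add: k_def field_simps)
  qed
  then have y': "0 \<le> y - k - \<eta>" using \<eta> y by simp
  have phi_step: "phi l (max 0 (\<rho> - k - z)) (y - k - \<eta>) \<le> phi l (max 0 (\<rho> - z)) y + (ln (real l) + 1) * X"
    if X: "0 \<le> X" "max 0 (\<rho> - z) * \<eta> + (v - z) * k \<le> X * y" for X z
  proof (rule phi_shrink)
    define a where "a = max 0 (\<rho> - z)"
    show "max 0 (\<rho> - k - z) - max 0 (\<rho> - z) * ((y - k - \<eta>) / y) \<le> X"
    proof (cases "\<rho> - k - z \<le> 0")
      case True
      then show ?thesis using X(1) y' y(2) by (smt (verit) divide_nonneg_nonneg mult_nonneg_nonneg)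
    next
      case False
      then have a: "a = \<rho> - z" using k0 by (simp add: a_def)
      have "(max 0 (\<rho> - k - z) - a * ((y - k - \<eta>) / y)) * y = (a - k) * y - a * (y - k - \<eta>)"
      proof -
        have "a * ((y - k - \<eta>) / y) * y = a * (y - k - \<eta>)" using y by simp
        moreover have "max 0 (\<rho> - k - z) = a - k" using False a by simp
        ultimately show ?thesis by (simp only: left_diff_distrib)
      qed
      also have "\<dots> = a * \<eta> + (a - y) * k" by (simp add: algebra_simps)
      also have "\<dots> = a * \<eta> + (v - z) * k" by (simp add: a y_def)
      also have "\<dots> \<le> X * y" using X(2) by (simp add: a_def)
      finally show ?thesis using y by (simp add: a_def)
    qed
  qed (use l y y' X \<eta> k0 in auto)
  show ?thesis
  proof (rule that[of "\<rho> - k"])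
    show "v + \<eta> \<le> \<rho> - k" using y' by (simp add: y_def)
    have E: "\<rho> - k - (v + \<eta>) = y - k - \<eta>" by (simp add: y_def)
    have R: "coord_pot l z (v + \<eta>) (\<rho> - k) \<le> coord_pot l z v \<rho> + 512 * (ln (real l) + 1) * X - 4 * \<eta>"
      if "0 \<le> X" "max 0 (\<rho> - z) * \<eta> + (v - z) * k \<le> X * y" for X z
    proof -
      have "max 0 (z - (\<rho> - k)) \<le> max 0 (z - \<rho>) + k" using k0 by auto
      moreover have "512 * p' + 4 * m' + 8 * (y - k - \<eta>) \<le> 512 * p + 4 * m + 8 * y + 512 * q - 4 * \<eta>"
        if "m' \<le> m + k" "p' \<le> p + q" for p p' m m' q :: real
        using that k0 \<eta> by argo
      ultimately show ?thesis using phi_step[OF that]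
        unfolding coord_pot_def E y_def[symmetric] mult.assoc by blast
    qed
    fix z
    show "coord_pot l z (v + \<eta>) (\<rho> - k) \<le> coord_pot l z v \<rho> - 4 * \<eta>" if z: "v + h / 2 \<le> z"
    proof -
      have "(v - z) * k \<le> (- (h / 2)) * k" using z k0 by (intro mult_right_mono) auto
      also have "\<dots> = - (y * \<eta>)" using h by (simp add: k_def)
      finally have "(v - z) * k \<le> - (y * \<eta>)" .
      moreover have "max 0 (\<rho> - z) * \<eta> \<le> y * \<eta>" using z y h \<eta> by (intro mult_right_mono) (auto simp: y_def)
      ultimately show ?thesis using R[of 0 z] by simp
    qed
    show "coord_pot l z (v + \<eta>) (\<rho> - k) \<le> coord_pot l z v \<rho>
           + 512 * (ln (real l) + 1) * (\<eta> + 6 * max 0 (v - z) * \<eta> / h)"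
    proof -
      define g where "g = max 0 (v - z)"
      \<comment> \<open>The 6 is 2 + 4: g k equals 2 g \<eta> y / h, and g \<eta> is at most 4 g
        \<eta> y / h because y exceeds h/4.\<close>
      define X where "X = \<eta> + 6 * g * \<eta> / h"
      have g: "0 \<le> g" by (simp add: g_def)
      have "max 0 (\<rho> - z) * \<eta> \<le> (y + g) * \<eta>" using \<eta> v by (intro mult_right_mono) (auto simp: y_def g_def)
      moreover have "(v - z) * k \<le> g * k" using k0 by (intro mult_right_mono) (auto simp: g_def)
      moreover have "g * \<eta> \<le> 4 * (g * \<eta> / h * y)"
      proof -
        have "g * \<eta> * h \<le> g * \<eta> * (4 * y)" using y g \<eta> by (intro mult_left_mono) auto
        then show ?thesis using h by (simp add: field_simps)
      qed
      moreover have "g * k = 2 * (g * \<eta> / h * y)" by (simp add: k_def)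
      moreover have "X * y = \<eta> * y + 6 * (g * \<eta> / h * y)" by (simp add: X_def distrib_right)
      moreover have "(y + g) * \<eta> = \<eta> * y + g * \<eta>" by (simp add: distrib_right)
      ultimately have "max 0 (\<rho> - z) * \<eta> + (v - z) * k \<le> X * y" by argo
      moreover have "0 \<le> X" using g \<eta> h by (simp add: X_def)
      ultimately show ?thesis using R[of X z] \<eta> by (simp add: X_def g_def)
    qed
  qed
qed

text \<open>The gain is t/4 times at least 7/16 of e/2 minus 1/16 of e, that is 5/128 of t
  e.\<close>

lemma evict_gain_sum:
  assumes l: "2 \<le> l" and S: "finite S" and e: "0 < e" and t: "0 \<le> t"
    and w: "\<And>i. i \<in> S \<Longrightarrow> 0 < w i" and y: "\<And>i. i \<in> S \<Longrightarrow> 0 \<le> y i" and a: "\<And>i. i \<in> S \<Longrightarrow> 0 \<le> a i"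
    and D: "\<And>i. i \<in> S \<Longrightarrow> w i * D i = t * (y i + e / real l)" "\<And>i. i \<in> S \<Longrightarrow> D i \<le> e / real l"
    and ysum: "(\<Sum>i\<in>S. y i) \<le> e" and asum: "e / 2 \<le> (\<Sum>i\<in>S. a i)"
  shows "5 / 128 * (t * e) \<le> (\<Sum>i\<in>S. w i * (phi l (a i) (y i) - phi l (a i) (y i + D i)))"
proof -
  have D0: "0 \<le> D i" if "i \<in> S" for i
  proof -
    have "0 \<le> w i * D i" unfolding D(1)[OF that] using t y[OF that] e by simp
    then show ?thesis using w[OF that] by (simp add: zero_le_mult_iff)
  qed
  \<comment> \<open>Truncation at e is harmless: a single truncated gap already contributes e, and
    if none is truncated the sum is unchanged.\<close>
  have min_sum: "e / 2 \<le> (\<Sum>i\<in>S. min (a i) e)"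
  proof (cases "\<exists>j\<in>S. e \<le> a j")
    case True
    then obtain j where j: "j \<in> S" "e \<le> a j" by auto
    have "min (a j) e \<le> (\<Sum>i\<in>S. min (a i) e)" using j S a e by (intro member_le_sum) auto
    then show ?thesis using j e by simp
  next
    case False
    then have "(\<Sum>i\<in>S. min (a i) e) = (\<Sum>i\<in>S. a i)" by (intro sum.cong) (auto simp: min_def)
    then show ?thesis using asum by simp
  qed
  have "5 / 128 * (t * e) = t / 4 * (7 / 16 * (e / 2) - e / 16)" by (simp add: field_simps)
  also have "\<dots> \<le> t / 4 * (7 / 16 * (\<Sum>i\<in>S. min (a i) e) - (\<Sum>i\<in>S. y i) / 16)"
    using min_sum ysum t by (intro mult_left_mono) auto
  also have "\<dots> = (\<Sum>i\<in>S. t / 4 * (7 / 16 * min (a i) e - y i / 16))"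
    by (simp only: sum_distrib_left[symmetric] sum_subtractf sum_divide_distrib[symmetric])
  also have "\<dots> \<le> (\<Sum>i\<in>S. w i * (phi l (a i) (y i) - phi l (a i) (y i + D i)))"
    using l a y e D D0 w t by (intro sum_mono phi_decrease_proportional) auto
  finally show ?thesis .
qed

section \<open>Total potential, algorithm states and the competitive ratio\<close>

locale weighted_allocation =
  fixes l :: nat and w :: "nat \<Rightarrow> real"
  assumes l2: "2 \<le> l" and w_pos: "i < l \<Longrightarrow> 0 < w i"
begin

definition pot :: "(nat \<Rightarrow> real) \<Rightarrow> (nat \<Rightarrow> real) \<Rightarrow> (nat \<Rightarrow> real) \<Rightarrow> real" where
  "pot z x \<rho> = (\<Sum>i<l. w i * coord_pot l (z i) (x i) (\<rho> i))"

definition state :: "(nat \<Rightarrow> real) \<Rightarrow> (nat \<Rightarrow> real) \<Rightarrow> bool" where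
  "state x \<rho> \<longleftrightarrow> x \<in> simplex l \<and> (\<forall>i<l. x i \<le> \<rho> i)"

text \<open>When the comparator pays at least half, the requested coordinate costs 512 * 6 = 3072
  times (ln l + 1) times its payment. Eviction, movement and service add at most 20 times the
  service cost, hence 40 times the payment; 3200 rounds the total up. Movement of the comparator
  needs only 516.\<close>

definition ratio :: real where
  "ratio = 3200 * (ln (real l) + 1)"

lemma ln_l: "0 \<le> ln (real l)"
  using l2 by simp

lemma ratio_pos: "0 < ratio"
  using ln_l by (simp add: ratio_def)

lemma simplex_nonneg: "x \<in> simplex l \<Longrightarrow> i < l \<Longrightarrow> 0 \<le> x i"
  by (simp add: simplex_def)

lemma simplex_le_1: "x \<in> simplex l \<Longrightarrow> i < l \<Longrightarrow> x i \<le> 1"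
  by (simp add: simplex_def)

lemma simplex_sum: "x \<in> simplex l \<Longrightarrow> (\<Sum>i<l. x i) = 1"
  by (simp add: simplex_def)

lemma simplexI:
  assumes "\<And>i. i < l \<Longrightarrow> 0 \<le> x i" "(\<Sum>i<l. x i) = 1"
  shows "x \<in> simplex l"
proof -
  have "x i \<le> 1" if "i < l" for i
    using member_le_sum[of i "{..<l}" x] that assms by auto
  then show ?thesis using assms by (auto simp: simplex_def)
qed

lemma pot_nonneg: "state x \<rho> \<Longrightarrow> 0 \<le> pot z x \<rho>"
  unfolding pot_def state_def using l2 w_pos
  by (intro sum_nonneg mult_nonneg_nonneg coord_pot_nonneg) (auto intro: less_imp_le)

lemma pot_Lipschitz:
  assumes "state x \<rho>"
  shows "pot z' x \<rho> \<le> pot z x \<rho> + ratio * move_cost l w z z'"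
proof -
  have "w i * coord_pot l (z' i) (x i) (\<rho> i) \<le>
      w i * coord_pot l (z i) (x i) (\<rho> i) + ratio * (w i * \<bar>z' i - z i\<bar>)" if "i < l" for i
  proof -
    have "coord_pot l (z' i) (x i) (\<rho> i) \<le> coord_pot l (z i) (x i) (\<rho> i) + 516 * (ln (real l) + 1) * \<bar>z' i - z i\<bar>"
      using that assms l2 by (intro coord_pot_Lipschitz) (auto simp: state_def)
    also have "516 * (ln (real l) + 1) * \<bar>z' i - z i\<bar> \<le> ratio * \<bar>z' i - z i\<bar>"
      using ln_l by (intro mult_right_mono) (auto simp: ratio_def)
    finally have "w i * coord_pot l (z' i) (x i) (\<rho> i) \<le> w i * (coord_pot l (z i) (x i) (\<rho> i) + ratio * \<bar>z' i - z i\<bar>)"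
      using w_pos[OF that] by (intro mult_left_mono) auto
    then show ?thesis by (simp add: algebra_simps)
  qed
  then show ?thesis unfolding pot_def move_cost_def sum_distrib_left sum.distrib[symmetric]
    by (intro sum_mono) auto
qed

lemma move_cost_triangle: "move_cost l w x z \<le> move_cost l w x y + move_cost l w y z"
proof -
  have "w i * \<bar>z i - x i\<bar> \<le> w i * \<bar>y i - x i\<bar> + w i * \<bar>z i - y i\<bar>" if "i < l" for i
    using w_pos[OF that] by (simp add: distrib_left[symmetric])
  then show ?thesis unfolding move_cost_def sum.distrib[symmetric] by (intro sum_mono) auto
qed

lemma move_cost_refl [simp]: "move_cost l w x x = 0"
  by (simp add: move_cost_def)

section \<open>Moving mass into the requested coordinate\<close>

definition load :: "nat \<Rightarrow> (nat \<Rightarrow> real) \<Rightarrow> (nat \<Rightarrow> real) \<Rightarrow> nat \<Rightarrow> real" where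
  "load r D x = (\<lambda>i. if i = r then x r + (\<Sum>j\<in>{..<l} - {r}. D j) else x i - D i)"

lemma sum_remove_coord: "r < l \<Longrightarrow> (\<Sum>i<l. f i) = f r + (\<Sum>i\<in>{..<l} - {r}. f i)" for f :: "nat \<Rightarrow> real"
  by (intro sum.remove) auto

lemma load_simplex:
  assumes "x \<in> simplex l" "r < l" "\<And>i. i < l \<Longrightarrow> i \<noteq> r \<Longrightarrow> 0 \<le> D i \<and> D i \<le> x i"
  shows "load r D x \<in> simplex l"
proof (rule simplexI)
  have "(\<Sum>i\<in>{..<l} - {r}. load r D x i) = (\<Sum>i\<in>{..<l} - {r}. x i - D i)"
    by (intro sum.cong) (auto simp: load_def)
  then have "(\<Sum>i<l. load r D x i) = (\<Sum>i<l. x i)"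
    using assms(2) by (simp add: sum_remove_coord load_def sum_subtractf)
  then show "(\<Sum>i<l. load r D x i) = 1" using assms by (simp add: simplex_sum)
  fix i assume "i < l"
  show "0 \<le> load r D x i"
  proof (cases "i = r")
    case True
    have "0 \<le> (\<Sum>j\<in>{..<l} - {r}. D j)" using assms by (intro sum_nonneg) auto
    then show ?thesis using True simplex_nonneg[of x r] assms by (simp add: load_def)
  qed (use assms \<open>i < l\<close> in \<open>auto simp: load_def\<close>)
qed

lemma load_move_cost:
  assumes "r < l" "\<And>i. i < l \<Longrightarrow> i \<noteq> r \<Longrightarrow> 0 \<le> D i"
  shows "move_cost l w x (load r D x) = w r * (\<Sum>j\<in>{..<l} - {r}. D j) + (\<Sum>j\<in>{..<l} - {r}. w j * D j)"
proof -
  have "0 \<le> (\<Sum>j\<in>{..<l} - {r}. D j)" using assms by (intro sum_nonneg) auto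
  moreover have "(\<Sum>i\<in>{..<l} - {r}. w i * \<bar>load r D x i - x i\<bar>) = (\<Sum>j\<in>{..<l} - {r}. w j * D j)"
    using assms by (intro sum.cong) (auto simp: load_def)
  ultimately show ?thesis unfolding move_cost_def sum_remove_coord[OF assms(1)] by (simp add: load_def)
qed

text \<open>Its size bounds how often a step is cut short because a coordinate runs empty.\<close>

definition support_except :: "nat \<Rightarrow> (nat \<Rightarrow> real) \<Rightarrow> nat set" where
  "support_except r x = {i. i < l \<and> i \<noteq> r \<and> 0 < x i}"

lemma finite_support_except [simp]: "finite (support_except r x)"
  unfolding support_except_def by simp

lemma support_except_subset: "support_except r x \<subseteq> {..<l} - {r}"
  unfolding support_except_def by auto

lemma sum_support_except:
  assumes "x \<in> simplex l" "r < l"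
  shows "(\<Sum>i\<in>support_except r x. x i) = 1 - x r"
proof -
  have "(\<Sum>i\<in>support_except r x. x i) = (\<Sum>i\<in>{..<l} - {r}. x i)"
  proof (rule sum.mono_neutral_left)
    show "\<forall>i\<in>{..<l} - {r} - support_except r x. x i = 0"
      using simplex_nonneg[OF assms(1)] by (force simp: support_except_def)
  qed (auto simp: support_except_def)
  then show ?thesis using simplex_sum[OF assms(1)] sum_remove_coord[OF assms(2), of x] by simp
qed

text \<open>Exact bookkeeping: outside r only y changes, growing by D, so each coordinate
  contributes its linear rise and its drop of \<open>phi\<close>. The new reference value \<sigma>
  at r stays free, since different moves choose it differently.\<close>

lemma pot_load:
  assumes st: "state x \<rho>" and r: "r < l" and D: "\<And>i. i \<notin> support_except r x \<Longrightarrow> D i = 0"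
  shows "pot z (load r D x) (\<rho>(r := \<sigma>)) = pot z x \<rho>
    + w r * (coord_pot l (z r) (x r + (\<Sum>i\<in>support_except r x. D i)) \<sigma> - coord_pot l (z r) (x r) (\<rho> r))
    + 8 * (\<Sum>i\<in>support_except r x. w i * D i)
    - 512 * (\<Sum>i\<in>support_except r x. w i * (phi l (max 0 (\<rho> i - z i)) (\<rho> i - x i)
               - phi l (max 0 (\<rho> i - z i)) (\<rho> i - x i + D i)))"
proof -
  let ?S = "support_except r x"
  let ?g = "\<lambda>i. phi l (max 0 (\<rho> i - z i)) (\<rho> i - x i) - phi l (max 0 (\<rho> i - z i)) (\<rho> i - x i + D i)"
  have restrict: "(\<Sum>i\<in>{..<l} - {r}. f i) = (\<Sum>i\<in>?S. f i)" if "\<And>i. i \<notin> ?S \<Longrightarrow> f i = 0" for f :: "nat \<Rightarrow> real"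
    using that support_except_subset by (intro sum.mono_neutral_right) auto
  have "w i * coord_pot l (z i) (load r D x i) ((\<rho>(r := \<sigma>)) i)
      = w i * coord_pot l (z i) (x i) (\<rho> i) + (8 * (w i * D i) - 512 * (w i * ?g i))" if "i \<in> {..<l} - {r}" for i
  proof -
    have eq: "coord_pot l (z i) (x i - D i) (\<rho> i) = coord_pot l (z i) (x i) (\<rho> i) + 8 * D i - 512 * ?g i"
      unfolding coord_pot_def by (simp add: algebra_simps)
    show ?thesis using that by (simp add: load_def eq distrib_left right_diff_distrib)
  qed
  then have "(\<Sum>i\<in>{..<l} - {r}. w i * coord_pot l (z i) (load r D x i) ((\<rho>(r := \<sigma>)) i))
      = (\<Sum>i\<in>{..<l} - {r}. w i * coord_pot l (z i) (x i) (\<rho> i) + (8 * (w i * D i) - 512 * (w i * ?g i)))"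
    by (intro sum.cong) auto
  also have "\<dots> = (\<Sum>i\<in>{..<l} - {r}. w i * coord_pot l (z i) (x i) (\<rho> i))
      + (8 * (\<Sum>i\<in>{..<l} - {r}. w i * D i) - 512 * (\<Sum>i\<in>{..<l} - {r}. w i * ?g i))"
    by (simp only: sum.distrib sum_subtractf sum_distrib_left)
  also have "(\<Sum>i\<in>{..<l} - {r}. w i * D i) = (\<Sum>i\<in>?S. w i * D i)" using D by (intro restrict) auto
  also have "(\<Sum>i\<in>{..<l} - {r}. w i * ?g i) = (\<Sum>i\<in>?S. w i * ?g i)" using D by (intro restrict) auto
  finally show ?thesis
    using restrict[of D] D unfolding pot_def sum_remove_coord[OF r]
    by (simp add: load_def right_diff_distrib)
qed

text \<open>The supporting line acts for a duration d' of at most d. If a coordinate empties first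
  the step ends early, but then the support has shrunk, which secures termination. The smallness of
  c d keeps the inflow \<eta> below h / (8 l); this gives both \<eta> \<le> h/8 for the new
  reference point and D \<le> e/l for the eviction gain.\<close>

lemma elementary_step:
  assumes st: "state x \<rho>" and r: "r < l" and c: "0 < c" and h: "0 < h" and d: "0 < d"
    and d_small: "c * d \<le> w r / (8 * real l)" and xr: "x r < 1"
  obtains x' \<rho>' d' where "0 < d'" "d' \<le> d" "state x' \<rho>'" "x r \<le> x' r"
    "card (support_except r x') \<le> card (support_except r x)"
    "d' = d \<or> card (support_except r x') < card (support_except r x)"
    "\<And>z. z \<in> simplex l \<Longrightarrow> pot z x' \<rho>' + move_cost l w x x' + d' * (c * h)
       \<le> pot z x \<rho> + ratio * (d' * (c * max 0 (x r + h - z r)))"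
proof -
  have xs: "x \<in> simplex l" and x\<rho>: "\<And>i. i < l \<Longrightarrow> x i \<le> \<rho> i" using st by (auto simp: state_def)
  define S where "S = support_except r x"
  define y where "y i = \<rho> i - x i" for i
  define e where "e = (\<Sum>i\<in>S. y i) + h"
  define k where "k i = (y i + e / real l) / w i" for i
  define H where "H = (\<Sum>i\<in>S. k i)"
  \<comment> \<open>The service cost q' = t K of the step dominates both the eviction scale t e and
    the inflow cost w_r \<eta>, and equals one of them. The first fact bounds all costs by q'; the
    second lets the potential drop pay for q'.\<close>
  define K where "K = max e (w r * H)"
  define q where "q = c * h * d"
  \<comment> \<open>Either the whole duration d is used up, or the first coordinate of the support
    reaches zero.\<close>
  define t where "t = min (q / K) (Min ((\<lambda>i. x i / k i) ` S))"
  define D where "D i = (if i \<in> S then t * k i else 0)" for i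
  define \<eta> where "\<eta> = t * H"
  define q' where "q' = t * K"
  define d' where "d' = q' / (c * h)"
  have l0: "0 < real l" using l2 by simp
  have wr: "0 < w r" using w_pos r by simp
  have S: "finite S" "\<And>i. i \<in> S \<Longrightarrow> i < l \<and> i \<noteq> r \<and> 0 < x i \<and> 0 < w i \<and> 0 \<le> y i"
    using x\<rho> w_pos by (auto simp: S_def support_except_def y_def)
  have Sx: "(\<Sum>i\<in>S. x i) = 1 - x r" using sum_support_except[OF xs r] by (simp add: S_def)
  then have S_ne: "S \<noteq> {}" using xr by auto
  have card_S: "real (card S) \<le> real l"
    using card_mono[of "{..<l}" S] S by (auto simp: subset_iff)
  have ysum: "0 \<le> (\<Sum>i\<in>S. y i)" using S by (intro sum_nonneg) auto
  then have e: "0 < e" "h \<le> e" using h by (auto simp: e_def)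
  have k: "0 < k i" if "i \<in> S" for i
    using S(2)[OF that] e l0 by (auto simp: k_def intro!: divide_pos_pos add_nonneg_pos)
  have H: "0 < H" unfolding H_def using S S_ne k by (intro sum_pos) auto
  have K: "0 < K" "e \<le> K" "w r * H \<le> K" using e by (auto simp: K_def)
  have q: "0 < q" using c h d by (simp add: q_def)
  have t0: "0 < t" using q K S S_ne k by (auto simp: t_def)
  have tk: "t * k i \<le> x i" if "i \<in> S" for i
  proof -
    have "t \<le> x i / k i" using S that by (auto simp: t_def intro!: min.coboundedI2)
    then show ?thesis using k[OF that] by (simp add: pos_le_divide_eq)
  qed
  have q': "0 < q'" "q' \<le> q" "t * e \<le> q'" "w r * \<eta> \<le> q'" "q' = t * e \<or> q' = w r * \<eta>"
  proof -
    show "0 < q'" using t0 K by (simp add: q'_def)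
    have "t \<le> q / K" by (simp add: t_def)
    then show "q' \<le> q" using K by (simp add: q'_def pos_le_divide_eq)
    show "t * e \<le> q'" using t0 K by (simp add: q'_def)
    have "t * (w r * H) \<le> t * K" using t0 K by (intro mult_left_mono) auto
    then show "w r * \<eta> \<le> q'" by (simp add: q'_def \<eta>_def mult.left_commute)
    show "q' = t * e \<or> q' = w r * \<eta>" by (auto simp: q'_def \<eta>_def K_def max_def)
  qed
  have D: "0 \<le> D i" "D i \<le> x i" if "i < l" for i
    using that tk[of i] k[of i] t0 simplex_nonneg[OF xs that] by (auto simp: D_def intro: less_imp_le)
  have D_sum: "(\<Sum>i\<in>S. D i) = \<eta>" by (simp add: D_def \<eta>_def H_def sum_distrib_left)
  have D_sum': "(\<Sum>i\<in>{..<l} - {r}. D i) = \<eta>" unfolding D_sum[symmetric]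
    using S by (intro sum.mono_neutral_right) (auto simp: D_def)
  have \<eta>: "0 \<le> \<eta>" "\<eta> \<le> h / (8 * real l)"
  proof -
    show "0 \<le> \<eta>" using t0 H by (simp add: \<eta>_def)
    have "w r * \<eta> \<le> h * (c * d)" using q' by (simp add: q_def mult_ac)
    also have "\<dots> \<le> h * (w r / (8 * real l))" using d_small h by (intro mult_left_mono) auto
    also have "\<dots> = w r * (h / (8 * real l))" by simp
    finally show "\<eta> \<le> h / (8 * real l)" using wr mult_le_cancel_left_pos by blast
  qed
  have "h / (8 * real l) \<le> h / 8" using h l2 by (intro divide_left_mono) auto
  then have \<eta>8: "\<eta> \<le> h / 8" using \<eta> by simp
  have De: "D i \<le> e / real l" if "i \<in> S" for i
  proof -
    have "D i \<le> \<eta>" unfolding D_sum[symmetric] using S D that by (intro member_le_sum) auto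
    also have "\<dots> \<le> e / real l" using \<eta>(2) e h l0 by (smt (verit) divide_right_mono frac_le)
    finally show ?thesis .
  qed
  have wD: "w i * D i = t * (y i + e / real l)" if "i \<in> S" for i
    using S(2)[OF that] that by (simp add: D_def k_def)
  have wD_sum: "(\<Sum>i\<in>S. w i * D i) \<le> 2 * (t * e)"
  proof -
    have "(\<Sum>i\<in>S. w i * D i) = t * ((\<Sum>i\<in>S. y i) + real (card S) * (e / real l))"
      using wD by (simp add: sum.distrib sum_distrib_left[symmetric])
    also have "\<dots> \<le> t * (e + real l * (e / real l))"
      using t0 h e l0 card_S by (intro mult_left_mono add_mono mult_right_mono) (auto simp: e_def)
    finally show ?thesis using l0 by simp
  qed
  have wD_sum': "(\<Sum>i\<in>{..<l} - {r}. w i * D i) = (\<Sum>i\<in>S. w i * D i)"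
    using S by (intro sum.mono_neutral_right) (auto simp: D_def)
  obtain \<sigma> where \<sigma>: "x r + \<eta> \<le> \<sigma>"
    and \<sigma>A: "\<And>z. x r + h / 2 \<le> z \<Longrightarrow> coord_pot l z (x r + \<eta>) \<sigma> \<le> coord_pot l z (x r) (\<rho> r) - 4 * \<eta>"
    and \<sigma>B: "\<And>z. z < x r + h / 2 \<Longrightarrow> coord_pot l z (x r + \<eta>) \<sigma> \<le> coord_pot l z (x r) (\<rho> r)
           + 512 * (ln (real l) + 1) * (\<eta> + 6 * max 0 (x r - z) * \<eta> / h)"
    using coord_pot_load[of l "x r" "\<rho> r" h \<eta>] l2 x\<rho>[OF r] h \<eta>(1) \<eta>8 by auto
  define x' where "x' = load r D x"
  have x's: "x' \<in> simplex l" unfolding x'_def using xs r D by (intro load_simplex) auto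
  have x'r: "x' r = x r + \<eta>" by (simp add: x'_def load_def D_sum')
  have supp: "support_except r x' \<subseteq> S"
    using D by (auto simp: x'_def load_def S_def support_except_def D_def split: if_splits)
  have dq: "d' * (c * h) = q'" using c h by (simp add: d'_def)
  have move: "move_cost l w x x' \<le> w r * \<eta> + 2 * (t * e)"
    unfolding x'_def using load_move_cost[OF r, of D x] D D_sum' wD_sum' wD_sum by simp
  show ?thesis
  proof (rule that[of d' x' "\<rho>(r := \<sigma>)"])
    show "0 < d'" using q' c h by (simp add: d'_def)
    show "d' \<le> d" using q' c h by (simp add: d'_def q_def pos_divide_le_eq mult_ac)
    show "state x' (\<rho>(r := \<sigma>))"
      unfolding state_def using x's \<sigma> x'r x\<rho> D by (auto simp: x'_def load_def) (smt (verit))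
    show "x r \<le> x' r" using x'r \<eta> by simp
    show "card (support_except r x') \<le> card (support_except r x)"
      using supp by (intro card_mono) (auto simp: S_def)
    show "d' = d \<or> card (support_except r x') < card (support_except r x)"
    proof (cases "q / K \<le> Min ((\<lambda>i. x i / k i) ` S)")
      case True
      then have "q' = q" using K by (simp add: q'_def t_def)
      then show ?thesis using c h by (simp add: d'_def q_def)
    next
      case False
      then have "t = Min ((\<lambda>i. x i / k i) ` S)" by (simp add: t_def)
      moreover have "Min ((\<lambda>i. x i / k i) ` S) \<in> (\<lambda>i. x i / k i) ` S" using S S_ne by (intro Min_in) auto
      ultimately obtain j where j: "j \<in> S" "t = x j / k j" by auto
      then have "x' j = 0" using k[OF j(1)] S(2)[OF j(1)] by (auto simp: x'_def load_def D_def)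
      then have "j \<notin> support_except r x'" by (simp add: support_except_def)
      then have "support_except r x' \<subset> S" using j supp by auto
      then show ?thesis using psubset_card_mono[of S] S by (simp add: S_def)
    qed
    fix z assume z: "z \<in> simplex l"
    define a where "a i = max 0 (\<rho> i - z i)" for i
    define G where "G = (\<Sum>i\<in>S. w i * (phi l (a i) (y i) - phi l (a i) (y i + D i)))"
    define C where "C = coord_pot l (z r) (x r + \<eta>) \<sigma> - coord_pot l (z r) (x r) (\<rho> r)"
    have pot': "pot z x' (\<rho>(r := \<sigma>)) = pot z x \<rho> + w r * C + 8 * (\<Sum>i\<in>S. w i * D i) - 512 * G"
      unfolding x'_def using pot_load[OF st r, of D z \<sigma>] D_sum
      by (simp add: S_def[symmetric] D_def G_def a_def y_def C_def)
    have G0: "0 \<le> G" unfolding G_def using S D l2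
      by (intro sum_nonneg mult_nonneg_nonneg) (auto simp: a_def intro!: phi_decreasing intro: less_imp_le)
    define O' where "O' = d' * (c * max 0 (x r + h - z r))"
    have O': "0 \<le> O'" using c q' h by (simp add: O'_def d'_def)
    have "pot z x' (\<rho>(r := \<sigma>)) + move_cost l w x x' + q' \<le> pot z x \<rho> + ratio * O'"
    proof (cases "x r + h / 2 \<le> z r")
      case True
      \<comment> \<open>Scaled by 512 the gain is 20 t e. Of this, 16 goes to the linear terms and 2
        to movement. The remaining 2 t e, with 4 - 1 = 3 units of w_r \<eta>, covers q'.\<close>
      have "5 / 128 * (t * e) \<le> G" unfolding G_def
      proof (rule evict_gain_sum)
        show "(\<Sum>i\<in>S. y i) \<le> e" using h by (simp add: e_def)
        have "(\<Sum>i\<in>S. z i) \<le> (\<Sum>i\<in>{..<l} - {r}. z i)"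
          using S simplex_nonneg[OF z] by (intro sum_mono2) auto
        also have "\<dots> = 1 - z r" using simplex_sum[OF z] sum_remove_coord[OF r, of z] by simp
        finally have "(\<Sum>i\<in>S. z i) \<le> 1 - z r" .
        moreover have "(\<Sum>i\<in>S. \<rho> i - z i) \<le> (\<Sum>i\<in>S. a i)" by (intro sum_mono) (simp add: a_def)
        moreover have "(\<Sum>i\<in>S. \<rho> i) = (\<Sum>i\<in>S. y i) + (1 - x r)"
          unfolding Sx[symmetric] sum.distrib[symmetric] by (simp add: y_def)
        ultimately show "e / 2 \<le> (\<Sum>i\<in>S. a i)" using True ysum by (simp add: e_def sum_subtractf)
      qed (use l2 S e t0 wD De in \<open>auto simp: a_def\<close>)
      moreover have "w r * C \<le> w r * (- 4 * \<eta>)"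
        using \<sigma>A[OF True] wr by (intro mult_left_mono) (auto simp: C_def)
      moreover have "0 \<le> ratio * O'" using O' ratio_pos by simp
      moreover have "0 \<le> w r * \<eta>" "0 \<le> t * e" using wr \<eta> t0 e by auto
      ultimately show ?thesis using pot' move wD_sum q'(5) by auto
    next
      case False
      define g where "g = max 0 (x r - z r)"
      define L where "L = ln (real l) + 1"
      have L: "1 \<le> L" using ln_l by (simp add: L_def)
      have gq: "0 \<le> g * q' / h" using q' h by (simp add: g_def)
      have "O' = q' / h * max 0 (x r + h - z r)" using c h by (simp add: O'_def d'_def)
      also have "max 0 (x r + h - z r) = h + (x r - z r)" using False h by simp
      also have "q' / h * (h + (x r - z r)) = q' + q' * (x r - z r) / h" using h by (simp add: field_simps)
      finally have Oeq: "O' = q' + q' * (x r - z r) / h" .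
      \<comment> \<open>The comparator lies more than h/2 below the zero of the line, so it pays
        over half of q'. Once it is below x_r its payment also grows linearly in g, which offsets
        the g-term of the reference update.\<close>
      have Ob: "q' \<le> 2 * O'" "q' + 6 * (g * q' / h) \<le> 6 * O'"
      proof -
        have "q' * (- h / 2) \<le> q' * (x r - z r)" using False q' by (intro mult_left_mono) auto
        then have "- q' / 2 \<le> q' * (x r - z r) / h" using h by (simp add: field_simps)
        then show 1: "q' \<le> 2 * O'" unfolding Oeq by argo
        show "q' + 6 * (g * q' / h) \<le> 6 * O'"
        proof (cases "z r \<le> x r")
          case True
          then have "O' = q' + g * q' / h" unfolding Oeq g_def by simp
          then show ?thesis using q'(1) by argo
        next
          case False
          then have "g = 0" by (simp add: g_def)
          then show ?thesis using 1 O' by simp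
        qed
      qed
      have "w r * C \<le> w r * (512 * L * (\<eta> + 6 * g * \<eta> / h))"
        using \<sigma>B[of "z r"] False wr by (intro mult_left_mono) (auto simp: C_def L_def g_def)
      also have "\<dots> = 512 * L * (w r * \<eta> + 6 * (g * (w r * \<eta>) / h))" using h by (simp add: field_simps)
      also have "\<dots> \<le> 512 * L * (q' + 6 * (g * q' / h))"
        using L q' h by (intro mult_left_mono add_mono divide_right_mono) (auto simp: g_def)
      also have "\<dots> \<le> 512 * L * (6 * O')" using Ob L by (intro mult_left_mono) auto
      finally have "w r * C \<le> 3072 * (L * O')" by simp
      moreover have "O' \<le> L * O'" using mult_right_mono[OF L O'] by simp
      moreover have "ratio * O' = 3200 * (L * O')" by (simp add: ratio_def L_def)
      moreover have "0 \<le> L * O'" using L O' by simp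
      ultimately show ?thesis using pot' G0 move wD_sum q' Ob(1) by linarith
    qed
    then show "pot z x' (\<rho>(r := \<sigma>)) + move_cost l w x x' + d' * (c * h)
       \<le> pot z x \<rho> + ratio * (d' * (c * max 0 (x r + h - z r)))"
      by (simp only: dq O'_def)
  qed
qed

end

section \<open>Supporting lines and Lipschitz minorants of convex costs\<close>

text \<open>The slope is the supremum of the descents of chords to the right of v, at most L by the
  Lipschitz bound. To the left of v, the three-point inequality puts every such descent below that
  of the chord from x to v.\<close>

lemma convex_subgradient_real:
  fixes F :: "real \<Rightarrow> real"
  assumes v: "0 \<le> v" "v < 1"
    and mono: "\<And>x y. 0 \<le> x \<Longrightarrow> x \<le> y \<Longrightarrow> y \<le> 1 \<Longrightarrow> F y \<le> F x"
    and lip: "\<And>x y. 0 \<le> x \<Longrightarrow> x \<le> y \<Longrightarrow> y \<le> 1 \<Longrightarrow> F x - F y \<le> L * (y - x)"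
    and conv: "\<And>x v y. 0 \<le> x \<Longrightarrow> x < v \<Longrightarrow> v < y \<Longrightarrow> y \<le> 1 \<Longrightarrow> (y - x) * F v \<le> (y - v) * F x + (v - x) * F y"
  obtains c where "0 \<le> c" "c \<le> L" "\<And>x. 0 \<le> x \<Longrightarrow> x \<le> 1 \<Longrightarrow> F v - c * (x - v) \<le> F x"
proof -
  define s where "s y = (F v - F y) / (y - v)" for y
  define c where "c = (SUP y\<in>{v<..1}. s y)"
  have ne: "{v<..1} \<noteq> {}" using v by auto
  have sL: "s y \<le> L" if "y \<in> {v<..1}" for y
    using that v lip[of v y] by (simp add: s_def pos_divide_le_eq)
  have bdd: "bdd_above (s ` {v<..1})" using sL by (intro bdd_aboveI2)
  have up: "s y \<le> c" if "y \<in> {v<..1}" for y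
    unfolding c_def using bdd that by (intro cSUP_upper)
  show ?thesis
  proof (rule that[of c])
    have "0 \<le> s 1" using v mono[of v 1] by (simp add: s_def)
    then show "0 \<le> c" using up[of 1] v by simp
    show "c \<le> L" unfolding c_def using ne sL by (intro cSUP_least)
    fix x :: real assume x: "0 \<le> x" "x \<le> 1"
    consider "v < x" | "x = v" | "x < v" by linarith
    then show "F v - c * (x - v) \<le> F x"
    proof cases
      case 1
      then show ?thesis using up[of x] x by (simp add: s_def pos_divide_le_eq)
    next
      case 3
      have "c \<le> (F x - F v) / (v - x)" unfolding c_def
      proof (rule cSUP_least[OF ne])
        fix y assume y: "y \<in> {v<..1}"
        have "(y - x) * F v \<le> (y - v) * F x + (v - x) * F y" using conv[of x v y] x y 3 by simp
        then have "(F v - F y) * (v - x) \<le> (F x - F v) * (y - v)" by (simp add: algebra_simps)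
        then show "s y \<le> (F x - F v) / (v - x)" using y 3 by (simp add: s_def divide_simps mult_ac)
      qed
      then show ?thesis using 3 by (simp add: pos_le_divide_eq algebra_simps)
    qed simp
  qed
qed

text \<open>F is the infimal convolution of f with the one-sided penalty L (y - x)^+, shifted by f 1
  so that it vanishes at 1. Penalising only moves to the right suffices for a non-increasing f. The
  last clause recovers f from F: a near-minimiser y has cost close to F x, and if F x is bounded and
  L is large, it lies at most slightly to the right of x.\<close>

lemma convex_cost_Lipschitz_minorant:
  assumes f: "convex_cost f" and f1: "f 1 \<noteq> \<infinity>" and L: "0 \<le> L"
  obtains F :: "real \<Rightarrow> real" where
    "\<And>x. 0 \<le> x \<Longrightarrow> x \<le> 1 \<Longrightarrow> 0 \<le> F x" "F 1 = 0"
    "\<And>x y. 0 \<le> x \<Longrightarrow> x \<le> y \<Longrightarrow> y \<le> 1 \<Longrightarrow> F y \<le> F x"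
    "\<And>x y. 0 \<le> x \<Longrightarrow> x \<le> y \<Longrightarrow> y \<le> 1 \<Longrightarrow> F x - F y \<le> L * (y - x)"
    "\<And>x v y. 0 \<le> x \<Longrightarrow> x < v \<Longrightarrow> v < y \<Longrightarrow> y \<le> 1 \<Longrightarrow> (y - x) * F v \<le> (y - v) * F x + (v - x) * F y"
    "\<And>x. 0 \<le> x \<Longrightarrow> x \<le> 1 \<Longrightarrow> ereal (F x) + f 1 \<le> f x"
    "\<And>x d. 0 \<le> x \<Longrightarrow> x \<le> 1 \<Longrightarrow> 0 < d \<Longrightarrow>
       \<exists>y. 0 \<le> y \<and> y \<le> 1 \<and> f y + ereal (L * max 0 (y - x)) \<le> ereal (F x + d) + f 1"
proof -
  define A where "A = {y. 0 \<le> y \<and> y \<le> 1 \<and> f y \<noteq> \<infinity>}"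
  define g where "g y = real_of_ereal (f y)" for y
  define p where "p x y = g y + L * max 0 (y - x)" for x y
  define I where "I x = (INF y\<in>A. p x y)" for x
  have A1: "1 \<in> A" using f1 by (simp add: A_def)
  have f0: "0 \<le> f x" if "0 \<le> x" "x \<le> 1" for x using f that by (simp add: convex_cost_def)
  have fg: "f y = ereal (g y)" if "y \<in> A" for y
    using f0[of y] that by (cases "f y") (auto simp: A_def g_def)
  have g1: "g 1 \<le> g y" if "y \<in> A" for y
  proof -
    have "f 1 \<le> f y" using f that by (auto simp: convex_cost_def A_def)
    then show ?thesis using fg[OF that] fg[OF A1] by simp
  qed
  have p1: "g 1 \<le> p x y" if "y \<in> A" for x y using g1[OF that] L by (simp add: p_def add_increasing2)
  have I_le: "I x \<le> p x y" if "y \<in> A" for x y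
    unfolding I_def using p1 that by (intro cINF_lower bdd_belowI2)
  have I_ge: "b \<le> I x" if "\<And>y. y \<in> A \<Longrightarrow> b \<le> p x y" for b x
    unfolding I_def using A1 that by (intro cINF_greatest) auto
  have near: "\<exists>y\<in>A. p x y < I x + d" if "0 < d" for x d
  proof (rule ccontr)
    assume "\<not> ?thesis"
    then have "I x + d \<le> I x" by (intro I_ge) (auto simp: not_less)
    then show False using that by simp
  qed
  show ?thesis
  proof (rule that[of "\<lambda>x. I x - g 1"])
    show "0 \<le> I x - g 1" for x using I_ge[OF p1, of x] by simp
    have "I 1 \<le> g 1" using I_le[OF A1, of 1] by (simp add: p_def)
    then show "I 1 - g 1 = 0" using I_ge[OF p1, of 1] by simp
    show "I y - g 1 \<le> I x - g 1" if "x \<le> y" for x y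
    proof -
      have "I y \<le> p x z" if "z \<in> A" for z
      proof -
        have "p y z \<le> p x z" unfolding p_def using \<open>x \<le> y\<close> L by (intro add_left_mono mult_left_mono) auto
        then show ?thesis using I_le[OF that, of y] by simp
      qed
      then show ?thesis using I_ge[of "I y" x] by simp
    qed
    show "I x - g 1 - (I y - g 1) \<le> L * (y - x)" if "x \<le> y" for x y
    proof -
      have "I x - L * (y - x) \<le> p y z" if "z \<in> A" for z
      proof -
        have "L * max 0 (z - x) \<le> L * (max 0 (z - y) + (y - x))"
          using \<open>x \<le> y\<close> L by (intro mult_left_mono) auto
        then show ?thesis using I_le[OF that, of x] by (simp add: p_def distrib_left)
      qed
      then show ?thesis using I_ge[of "I x - L * (y - x)" y] by simp
    qed
    show "(y - x) * (I v - g 1) \<le> (y - v) * (I x - g 1) + (v - x) * (I y - g 1)"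
      if "0 \<le> x" "x < v" "v < y" "y \<le> 1" for x v y
    proof (rule field_le_epsilon)
      fix d :: real assume d: "0 < d"
      define d' where "d' = d / (y - x)"
      have d': "0 < d'" using d that by (simp add: d'_def)
      obtain a where a: "a \<in> A" "p x a < I x + d'" using near[OF d'] by blast
      obtain b where b: "b \<in> A" "p y b < I y + d'" using near[OF d'] by blast
      \<comment> \<open>The near-minimisers for x and y are combined with the weights that express v
        through x and y; convexity of f and of the penalty gives the inequality up to d'.\<close>
      define u where "u = (y - v) / (y - x)"
      have u: "0 < u" "u < 1" and u': "1 - u = (v - x) / (y - x)" using that by (auto simp: u_def field_simps)
      have v: "v = u * x + (1 - u) * y" using that unfolding u' unfolding u_def
        by (simp add: divide_simps) (simp add: algebra_simps)
      define m where "m = u * a + (1 - u) * b"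
      have fm: "f m \<le> ereal u * f a + ereal (1 - u) * f b"
        using f a b u by (simp add: convex_cost_def A_def m_def)
      have m01: "0 \<le> m" "m \<le> 1"
        using a b u convex_bound_le[of a 1 b u "1 - u"] by (auto simp: m_def A_def)
      have fm': "f m \<le> ereal (u * g a + (1 - u) * g b)" using fm fg[OF a(1)] fg[OF b(1)] by simp
      then have mA: "m \<in> A" using m01 by (auto simp: A_def)
      have gm: "g m \<le> u * g a + (1 - u) * g b" using fm' fg[OF mA] by simp
      have "max 0 (m - v) \<le> u * max 0 (a - x) + (1 - u) * max 0 (b - y)"
      proof -
        have "m - v = u * (a - x) + (1 - u) * (b - y)" by (simp add: m_def v algebra_simps)
        also have "\<dots> \<le> u * max 0 (a - x) + (1 - u) * max 0 (b - y)"
          using u by (intro add_mono mult_left_mono) auto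
        finally show ?thesis using u by simp
      qed
      then have "L * max 0 (m - v) \<le> L * (u * max 0 (a - x) + (1 - u) * max 0 (b - y))"
        using L by (rule mult_left_mono)
      then have "p v m \<le> u * p x a + (1 - u) * p y b" using gm by (simp add: p_def algebra_simps)
      also have "\<dots> \<le> u * (I x + d') + (1 - u) * (I y + d')"
        using a b u by (intro add_mono mult_left_mono) auto
      finally have "I v \<le> u * (I x + d') + (1 - u) * (I y + d')" using I_le[OF mA, of v] by simp
      then have "I v - g 1 \<le> u * (I x - g 1) + (1 - u) * (I y - g 1) + d'" by (simp add: algebra_simps)
      then have "(y - x) * (I v - g 1) \<le> (y - x) * (u * (I x - g 1) + (1 - u) * (I y - g 1) + d')"
        using that by (intro mult_left_mono) auto
      also have "\<dots> = ((y - x) * u) * (I x - g 1) + ((y - x) * (1 - u)) * (I y - g 1) + (y - x) * d'"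
        by (simp add: algebra_simps)
      also have "(y - x) * u = y - v" using that by (simp add: u_def)
      also have "(y - x) * (1 - u) = v - x" using that by (simp add: u')
      also have "(y - x) * d' = d" using that by (simp add: d'_def)
      finally show "(y - x) * (I v - g 1) \<le> (y - v) * (I x - g 1) + (v - x) * (I y - g 1) + d" .
    qed
    show "ereal (I x - g 1) + f 1 \<le> f x" if "0 \<le> x" "x \<le> 1" for x
    proof (cases "f x = \<infinity>")
      case False
      then have "x \<in> A" using that by (simp add: A_def)
      then show ?thesis using I_le[of x x] fg[of x] fg[OF A1] by (simp add: p_def)
    qed simp
    show "\<exists>y. 0 \<le> y \<and> y \<le> 1 \<and> f y + ereal (L * max 0 (y - x)) \<le> ereal (I x - g 1 + d) + f 1"
      if d: "0 < d" for x d
    proof -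
      obtain y where y: "y \<in> A" "p x y < I x + d" using near[OF d] by blast
      then show ?thesis using fg[of y] fg[OF A1] by (intro exI[of _ y]) (auto simp: p_def A_def)
    qed
  qed
qed

section \<open>Serving one request\<close>

context weighted_allocation
begin

text \<open>T is the duration for which F still has to be charged. Convexity enters through the
  supporting line at x_r: it agrees with F there, so the algorithm is charged correctly, and lies
  below F elsewhere, so the comparator is never overcharged.\<close>

lemma serve_Lipschitz:
  fixes F :: "real \<Rightarrow> real"
  assumes r: "r < l" and L: "0 < L"
    and nonneg: "\<And>x. 0 \<le> x \<Longrightarrow> x \<le> 1 \<Longrightarrow> 0 \<le> F x" and F1: "F 1 = 0"
    and mono: "\<And>x y. 0 \<le> x \<Longrightarrow> x \<le> y \<Longrightarrow> y \<le> 1 \<Longrightarrow> F y \<le> F x"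
    and lip: "\<And>x y. 0 \<le> x \<Longrightarrow> x \<le> y \<Longrightarrow> y \<le> 1 \<Longrightarrow> F x - F y \<le> L * (y - x)"
    and conv: "\<And>x v y. 0 \<le> x \<Longrightarrow> x < v \<Longrightarrow> v < y \<Longrightarrow> y \<le> 1 \<Longrightarrow> (y - x) * F v \<le> (y - v) * F x + (v - x) * F y"
    and st: "state x \<rho>" and T: "0 \<le> T"
  shows "\<exists>x' \<rho>'. state x' \<rho>' \<and> x r \<le> x' r \<and> (\<forall>z\<in>simplex l.
    pot z x' \<rho>' + move_cost l w x x' + T * F (x' r) \<le> pot z x \<rho> + ratio * (T * F (z r)))"
proof -
  \<comment> \<open>Every slope is at most L, so steps of duration up to b satisfy the smallness
    condition of \<open>elementary_step\<close>.\<close>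
  define b where "b = w r / (8 * real l * L)"
  have b: "0 < b" using w_pos[OF r] l2 L by (simp add: b_def)
  \<comment> \<open>A step of full duration lowers the rounded-up number of remaining steps; a
    shorter one removes a coordinate from the support. Neither summand ever grows.\<close>
  have "card (support_except r x) + nat \<lceil>T / b\<rceil> \<le> n \<Longrightarrow> ?thesis" for n
    using st T
  proof (induction n arbitrary: x \<rho> T)
    case 0
    then have "T = 0" using b by (simp add: divide_le_0_iff)
    then show ?case using 0 by - (rule exI[of _ x], rule exI[of _ \<rho>], simp)
  next
    case (Suc n)
    have xs: "x \<in> simplex l" using Suc.prems by (simp add: state_def)
    have xr: "0 \<le> x r" "x r \<le> 1" using simplex_nonneg[OF xs r] simplex_le_1[OF xs r] by auto
    have z01: "0 \<le> F (z r)" if "z \<in> simplex l" for z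
      using nonneg simplex_nonneg[OF that r] simplex_le_1[OF that r] by auto
    show ?case
    proof (cases "T = 0 \<or> F (x r) = 0")
      case True
      then show ?thesis using Suc.prems z01 ratio_pos
        by - (rule exI[of _ x], rule exI[of _ \<rho>], auto intro!: mult_nonneg_nonneg)
    next
      case False
      then have T0: "0 < T" and Fx: "0 < F (x r)" using Suc.prems nonneg[OF xr] by auto
      then have xr1: "x r < 1" using F1 xr by (cases "x r = 1") auto
      obtain c where c: "0 \<le> c" "c \<le> L" "\<And>y. 0 \<le> y \<Longrightarrow> y \<le> 1 \<Longrightarrow> F (x r) - c * (y - x r) \<le> F y"
        using convex_subgradient_real[OF xr(1) xr1 mono lip conv] by blast
      have c0: "0 < c" using c(3)[of 1] F1 Fx xr1 c(1) by (cases "c = 0") auto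
      define h where "h = F (x r) / c"
      define d where "d = min T b"
      have h: "0 < h" "c * h = F (x r)" using Fx c0 by (auto simp: h_def)
      have d: "0 < d" using T0 b by (simp add: d_def)
      have "c * d \<le> L * b" using c c0 d L by (intro mult_mono) (auto simp: d_def)
      also have "\<dots> = w r / (8 * real l)" using L by (simp add: b_def)
      finally obtain x1 \<rho>1 d1 where s1: "0 < d1" "d1 \<le> d" "state x1 \<rho>1" "x r \<le> x1 r"
        "card (support_except r x1) \<le> card (support_except r x)"
        "d1 = d \<or> card (support_except r x1) < card (support_except r x)"
        and p1: "\<And>z. z \<in> simplex l \<Longrightarrow> pot z x1 \<rho>1 + move_cost l w x x1 + d1 * (c * h)
         \<le> pot z x \<rho> + ratio * (d1 * (c * max 0 (x r + h - z r)))"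
        using elementary_step[OF Suc.prems(2) r c0 h(1) d _ xr1] by metis
      have T1: "0 \<le> T - d1" using s1 by (simp add: d_def)
      have "nat \<lceil>(T - d1) / b\<rceil> \<le> nat \<lceil>T / b\<rceil>"
        using s1 b by (intro nat_mono ceiling_mono divide_right_mono) auto
      moreover have "nat \<lceil>(T - d1) / b\<rceil> < nat \<lceil>T / b\<rceil>" if "d1 = d"
      proof -
        have pos: "0 < \<lceil>T / b\<rceil>" using T0 b by simp
        show ?thesis
        proof (cases "T \<le> b")
          case True
          then show ?thesis using that pos by (simp add: d_def)
        next
          case False
          then have "(T - d1) / b = T / b - 1" using that b by (simp add: d_def diff_divide_distrib)
          then show ?thesis using pos by simp
        qed
      qed
      ultimately have "card (support_except r x1) + nat \<lceil>(T - d1) / b\<rceil> \<le> n"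
        using s1(5,6) Suc.prems(1) by linarith
      from Suc.IH[OF this s1(3) T1] obtain x2 \<rho>2 where s2: "state x2 \<rho>2" "x1 r \<le> x2 r"
        and p2: "\<And>z. z \<in> simplex l \<Longrightarrow> pot z x2 \<rho>2 + move_cost l w x1 x2 + (T - d1) * F (x2 r)
           \<le> pot z x1 \<rho>1 + ratio * ((T - d1) * F (z r))" by blast
      have "x2 \<in> simplex l" using s2 by (simp add: state_def)
      then have "F (x2 r) \<le> F (x r)" using s1 s2 xr simplex_le_1[of x2 r] r by (intro mono) auto
      \<comment> \<open>Service is due only at the final point. As x_r never falls and F is
        non-increasing, the charges at intermediate points are large enough.\<close>
      then have F2: "d1 * F (x2 r) \<le> d1 * (c * h)" using s1(1) h by simp
      show ?thesis
      proof (rule exI[of _ x2], rule exI[of _ \<rho>2], intro conjI ballI)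
        show "x r \<le> x2 r" using s1 s2 by simp
        fix z assume z: "z \<in> simplex l"
        have "F (x r) - c * (z r - x r) \<le> F (z r)"
          using simplex_nonneg[OF z r] simplex_le_1[OF z r] by (intro c(3)) auto
        then have "c * (x r + h - z r) \<le> F (z r)" unfolding h(2)[symmetric] by (simp add: algebra_simps)
        then have "c * max 0 (x r + h - z r) \<le> F (z r)" using z01[OF z] c0 by (auto simp: max_def)
        then have "ratio * (d1 * (c * max 0 (x r + h - z r))) \<le> ratio * (d1 * F (z r))"
          using s1(1) ratio_pos by (intro mult_left_mono) auto
        moreover have "ratio * (d1 * F (z r)) + ratio * ((T - d1) * F (z r)) = ratio * (T * F (z r))"
          by (simp add: algebra_simps)
        moreover have "d1 * F (x2 r) + (T - d1) * F (x2 r) = T * F (x2 r)" by (simp add: algebra_simps)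
        ultimately show "pot z x2 \<rho>2 + move_cost l w x x2 + T * F (x2 r) \<le> pot z x \<rho> + ratio * (T * F (z r))"
          using p1[OF z] p2[OF z] F2 move_cost_triangle[of x x2 x1] by linarith
      qed (use s2 in simp)
    qed
  qed
  then show ?thesis by blast
qed

text \<open>Used to pass from the minorant back to the true cost. The reference value moves along
  with x_r, so the increase is proportional to \<theta> for every comparator: 513 is 512 plus one
  unit of movement, and 9 is 8 plus one.\<close>

lemma small_load:
  assumes st: "state x \<rho>" and r: "r < l" and \<theta>: "0 \<le> \<theta>" "x r + \<theta> \<le> 1"
  obtains x' \<rho>' where "state x' \<rho>'" "x' r = x r + \<theta>"
    "\<And>z. pot z x' \<rho>' + move_cost l w x x' \<le> pot z x \<rho> + (513 * (ln (real l) + 1) * w r + 9 * (\<Sum>i<l. w i)) * \<theta>"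
proof (cases "\<theta> = 0")
  case True
  then show ?thesis using that[of x \<rho>] st by simp
next
  case False
  have xs: "x \<in> simplex l" and x\<rho>: "\<And>i. i < l \<Longrightarrow> x i \<le> \<rho> i" using st by (auto simp: state_def)
  have xr: "0 < 1 - x r" using False \<theta> by simp
  define S where "S = support_except r x"
  \<comment> \<open>Removing mass in proportion to x keeps every coordinate nonnegative, as \<theta>
    is at most 1 - x_r.\<close>
  define D where "D i = (if i \<in> S then \<theta> * x i / (1 - x r) else 0)" for i
  have S: "finite S" "\<And>i. i \<in> S \<Longrightarrow> i < l \<and> i \<noteq> r \<and> 0 < x i" by (auto simp: S_def support_except_def)
  have Sx: "(\<Sum>i\<in>S. x i) = 1 - x r" using sum_support_except[OF xs r] by (simp add: S_def)
  have D_sum: "(\<Sum>i\<in>S. D i) = \<theta>"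
  proof -
    have "(\<Sum>i\<in>S. D i) = (\<Sum>i\<in>S. x i) * (\<theta> / (1 - x r))"
      unfolding sum_distrib_right by (intro sum.cong) (auto simp: D_def)
    then show ?thesis using xr by (simp add: Sx)
  qed
  have D_sum': "(\<Sum>i\<in>{..<l} - {r}. D i) = \<theta>" unfolding D_sum[symmetric]
    using S by (intro sum.mono_neutral_right) (auto simp: D_def)
  have D: "0 \<le> D i" "D i \<le> x i" if "i < l" for i
  proof -
    show "0 \<le> D i" using \<theta> xr S by (auto simp: D_def less_imp_le)
    have "\<theta> * x i \<le> (1 - x r) * x i" using \<theta> simplex_nonneg[OF xs that] by (intro mult_right_mono) auto
    then show "D i \<le> x i" using xr simplex_nonneg[OF xs that] by (simp add: D_def pos_divide_le_eq mult.commute)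
  qed
  have wD: "(\<Sum>i\<in>S. w i * D i) \<le> (\<Sum>i<l. w i) * \<theta>"
  proof -
    have "D i \<le> \<theta>" if "i \<in> S" for i unfolding D_sum[symmetric] using S D that by (intro member_le_sum) auto
    then have "(\<Sum>i\<in>S. w i * D i) \<le> (\<Sum>i\<in>S. w i * \<theta>)"
      using S w_pos by (intro sum_mono mult_left_mono) (auto intro: less_imp_le)
    also have "\<dots> \<le> (\<Sum>i<l. w i * \<theta>)"
      using S w_pos \<theta> by (intro sum_mono2 mult_nonneg_nonneg) (auto intro: less_imp_le)
    finally show ?thesis by (simp add: sum_distrib_right)
  qed
  have wD': "(\<Sum>i\<in>{..<l} - {r}. w i * D i) = (\<Sum>i\<in>S. w i * D i)"
    using S by (intro sum.mono_neutral_right) (auto simp: D_def)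
  have wr: "0 < w r" using w_pos[OF r] .
  show ?thesis
  proof (rule that[of "load r D x" "\<rho>(r := \<rho> r + \<theta>)"])
    show "state (load r D x) (\<rho>(r := \<rho> r + \<theta>))"
      unfolding state_def
    proof (intro conjI allI impI)
      show "load r D x \<in> simplex l" using xs r D by (intro load_simplex) auto
      fix i assume "i < l"
      then show "load r D x i \<le> (\<rho>(r := \<rho> r + \<theta>)) i"
        using x\<rho>[of i] D[of i] D_sum' by (auto simp: load_def)
    qed
    show "load r D x r = x r + \<theta>" by (simp add: load_def D_sum')
    fix z
    define C where "C = coord_pot l (z r) (x r + \<theta>) (\<rho> r + \<theta>) - coord_pot l (z r) (x r) (\<rho> r)"
    define G where "G = (\<Sum>i\<in>S. w i * (phi l (max 0 (\<rho> i - z i)) (\<rho> i - x i)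
               - phi l (max 0 (\<rho> i - z i)) (\<rho> i - x i + D i)))"
    have G0: "0 \<le> G" unfolding G_def using S D l2 w_pos x\<rho>
      by (intro sum_nonneg mult_nonneg_nonneg) (auto intro!: phi_decreasing intro: less_imp_le)
    have C: "C \<le> 512 * (ln (real l) + 1) * \<theta>"
      using coord_pot_shift[of l "x r" "\<rho> r" \<theta> "z r"] l2 x\<rho>[OF r] \<theta> by (simp add: C_def)
    have "w r * C \<le> w r * (512 * (ln (real l) + 1) * \<theta>)" using C wr by (intro mult_left_mono) auto
    moreover have "w r * \<theta> \<le> (ln (real l) + 1) * (w r * \<theta>)"
      using ln_l wr \<theta> mult_right_mono[of 1 "ln (real l) + 1" "w r * \<theta>"] by simp
    moreover have "pot z (load r D x) (\<rho>(r := \<rho> r + \<theta>)) = pot z x \<rho> + w r * C + 8 * (\<Sum>i\<in>S. w i * D i) - 512 * G"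
      using pot_load[OF st r, of D z "\<rho> r + \<theta>"] D_sum by (simp add: S_def[symmetric] D_def C_def G_def)
    moreover have "move_cost l w x (load r D x) = w r * \<theta> + (\<Sum>i\<in>S. w i * D i)"
      using load_move_cost[OF r, of D x] D D_sum' wD' by simp
    moreover have "(513 * (ln (real l) + 1) * w r + 9 * (\<Sum>i<l. w i)) * \<theta>
       = w r * (512 * (ln (real l) + 1) * \<theta>) + (ln (real l) + 1) * (w r * \<theta>) + 9 * ((\<Sum>i<l. w i) * \<theta>)"
      by (simp add: algebra_simps)
    ultimately show "pot z (load r D x) (\<rho>(r := \<rho> r + \<theta>)) + move_cost l w x (load r D x)
       \<le> pot z x \<rho> + (513 * (ln (real l) + 1) * w r + 9 * (\<Sum>i<l. w i)) * \<theta>"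
      using G0 wD by linarith
  qed
qed

text \<open>The point reached for the minorant depends on L, but its cost is bounded by a number W
  that does not; so L can be fixed after W, large enough that the final correction costs at most
  \<delta>/2.\<close>

lemma serve_request:
  assumes st: "state x \<rho>" and req: "valid_request l (r, f)" and \<delta>: "0 < \<delta>"
  shows "\<exists>x' \<rho>'. state x' \<rho>' \<and> (\<forall>z\<in>simplex l.
    ereal (pot z x' \<rho>' + move_cost l w x x') + f (x' r) \<le> ereal (pot z x \<rho> + \<delta>) + ereal ratio * f (z r))"
proof (cases "f 1 = \<infinity>")
  case True
  have "f (z r) = \<infinity>" if "z \<in> simplex l" for z
  proof -
    have "f 1 \<le> f (z r)" using req simplex_nonneg[OF that] simplex_le_1[OF that]
      by (auto simp: valid_request_def convex_cost_def)
    then show ?thesis using True by simp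
  qed
  \<comment> \<open>Every comparator pays an infinite cost here, so staying put is enough.\<close>
  then show ?thesis using st ratio_pos by - (rule exI[of _ x], rule exI[of _ \<rho>], simp)
next
  case False
  have r: "r < l" and f: "convex_cost f" using req by (auto simp: valid_request_def)
  define g where "g = real_of_ereal (f 1)"
  have "0 \<le> f 1" using f by (simp add: convex_cost_def)
  then have f1: "f 1 = ereal g" "0 \<le> g" using False by (cases "f 1"; simp add: g_def)+
  define K where "K = 513 * (ln (real l) + 1) * w r + 9 * (\<Sum>i<l. w i)"
  have "0 \<le> (\<Sum>i<l. w i)" using w_pos by (intro sum_nonneg) (auto intro: less_imp_le)
  then have K: "0 \<le> K" using ln_l w_pos[OF r]
    unfolding K_def by (intro add_nonneg_nonneg mult_nonneg_nonneg) auto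
  \<comment> \<open>Comparing with the vertex of the simplex at r, where the minorant vanishes,
    bounds F at the reached point by the potential W.\<close>
  define u :: "nat \<Rightarrow> real" where "u i = (if i = r then 1 else 0)" for i
  have u: "u \<in> simplex l" using r by (intro simplexI) (auto simp: u_def)
  define W where "W = pot u x \<rho>"
  have W: "0 \<le> W" unfolding W_def using st by (rule pot_nonneg)
  define L where "L = 1 + 2 * K * (W + 1) / \<delta>"
  have L: "0 < L" using K W \<delta> by (simp add: L_def add_pos_nonneg)
  have LK: "K * ((W + 1) / L) \<le> \<delta> / 2"
  proof -
    have "\<delta> * (2 * K * (W + 1) / \<delta>) = 2 * K * (W + 1)" using \<delta> by simp
    then have "2 * K * (W + 1) \<le> \<delta> * L" using \<delta> unfolding L_def distrib_left[of \<delta>] by linarith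
    then show ?thesis using L by (simp add: pos_divide_le_eq mult_ac)
  qed
  obtain F where F: "\<And>x. 0 \<le> x \<Longrightarrow> x \<le> 1 \<Longrightarrow> 0 \<le> F x" "F 1 = 0"
    "\<And>x y. 0 \<le> x \<Longrightarrow> x \<le> y \<Longrightarrow> y \<le> 1 \<Longrightarrow> F y \<le> F x"
    "\<And>x y. 0 \<le> x \<Longrightarrow> x \<le> y \<Longrightarrow> y \<le> 1 \<Longrightarrow> F x - F y \<le> L * (y - x)"
    "\<And>x v y. 0 \<le> x \<Longrightarrow> x < v \<Longrightarrow> v < y \<Longrightarrow> y \<le> 1 \<Longrightarrow> (y - x) * F v \<le> (y - v) * F x + (v - x) * F y"
    and Ff: "\<And>x. 0 \<le> x \<Longrightarrow> x \<le> 1 \<Longrightarrow> ereal (F x) + f 1 \<le> f x"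
    and near: "\<And>x d. 0 \<le> x \<Longrightarrow> x \<le> 1 \<Longrightarrow> 0 < d \<Longrightarrow>
       \<exists>y. 0 \<le> y \<and> y \<le> 1 \<and> f y + ereal (L * max 0 (y - x)) \<le> ereal (F x + d) + f 1"
    using convex_cost_Lipschitz_minorant[OF f False less_imp_le[OF L]] by blast
  obtain x1 \<rho>1 where s1: "state x1 \<rho>1"
    and p1: "\<And>z. z \<in> simplex l \<Longrightarrow> pot z x1 \<rho>1 + move_cost l w x x1 + F (x1 r) \<le> pot z x \<rho> + ratio * F (z r)"
    using serve_Lipschitz[OF r L F st, of 1] by auto
  have x1s: "x1 \<in> simplex l" using s1 by (simp add: state_def)
  have x1r: "0 \<le> x1 r" "x1 r \<le> 1" using simplex_nonneg[OF x1s r] simplex_le_1[OF x1s r] by auto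
  have "0 \<le> move_cost l w x x1" unfolding move_cost_def using w_pos
    by (intro sum_nonneg mult_nonneg_nonneg) (auto intro: less_imp_le)
  then have FW: "F (x1 r) \<le> W" using p1[OF u] pot_nonneg[OF s1, of u] F(2) by (simp add: W_def u_def)
  \<comment> \<open>The cap 1 gives L \<theta> \<le> W + 1; the cap \<delta>/2 leaves the other half
    of \<delta> for the correction move.\<close>
  define d where "d = min (\<delta> / 2) 1"
  have d: "0 < d" "d \<le> \<delta> / 2" "d \<le> 1" using \<delta> by (auto simp: d_def)
  obtain y where y: "0 \<le> y" "y \<le> 1" "f y + ereal (L * max 0 (y - x1 r)) \<le> ereal (F (x1 r) + d) + f 1"
    using near[OF x1r d(1)] by blast
  have fy0: "f 1 \<le> f y" using f y by (simp add: convex_cost_def)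
  obtain gy where gy: "f y = ereal gy" using y(3) fy0 f1 by (cases "f y") auto
  have gy': "g \<le> gy" "gy + L * max 0 (y - x1 r) \<le> F (x1 r) + d + g" using fy0 y(3) f1 gy by auto
  define \<theta> where "\<theta> = max 0 (y - x1 r)"
  have L\<theta>: "0 \<le> L * \<theta>" using L by (simp add: \<theta>_def)
  have "L * \<theta> \<le> W + 1" using gy' FW d by (simp add: \<theta>_def)
  then have "\<theta> \<le> (W + 1) / L" using L by (simp add: pos_le_divide_eq mult.commute)
  then have "K * \<theta> \<le> K * ((W + 1) / L)" using K by (rule mult_left_mono)
  from order_trans[OF this LK] have K\<theta>: "K * \<theta> \<le> \<delta> / 2" .
  have \<theta>: "0 \<le> \<theta>" "x1 r + \<theta> \<le> 1" using x1r y by (auto simp: \<theta>_def)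
  obtain x2 \<rho>2 where s2: "state x2 \<rho>2" "x2 r = x1 r + \<theta>"
    and p2: "\<And>z. pot z x2 \<rho>2 + move_cost l w x1 x2 \<le> pot z x1 \<rho>1 + K * \<theta>"
    using small_load[OF s1 r \<theta>] unfolding K_def[symmetric] by blast
  have "y \<le> x2 r" by (simp add: s2 \<theta>_def)
  then have "f (x2 r) \<le> f y" using f y(1) s2(2) \<theta>(2) by (simp add: convex_cost_def)
  also have "f y \<le> ereal (F (x1 r) + d + g)"
    unfolding gy ereal_less_eq using gy'(2)[folded \<theta>_def] L\<theta> by linarith
  finally have fx2: "f (x2 r) \<le> ereal (F (x1 r) + d + g)" .
  show ?thesis
  proof (rule exI[of _ x2], rule exI[of _ \<rho>2], intro conjI ballI)
    fix z assume z: "z \<in> simplex l"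
    show "ereal (pot z x2 \<rho>2 + move_cost l w x x2) + f (x2 r) \<le> ereal (pot z x \<rho> + \<delta>) + ereal ratio * f (z r)"
    proof (cases "f (z r) = \<infinity>")
      case True
      then show ?thesis using ratio_pos by simp
    next
      case False
      have z01: "0 \<le> z r" "z r \<le> 1" using simplex_nonneg[OF z r] simplex_le_1[OF z r] by auto
      have "0 \<le> f (z r)" using f z01 by (simp add: convex_cost_def)
      then obtain gz where gz: "f (z r) = ereal gz" using False by (cases "f (z r)") auto
      have "F (z r) + g \<le> gz" using Ff[OF z01] f1 gz by simp
      then have "ratio * (F (z r) + g) \<le> ratio * gz" using ratio_pos by (intro mult_left_mono) auto
      moreover have "1 * g \<le> ratio * g" using f1 ln_l by (intro mult_right_mono) (auto simp: ratio_def)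
      ultimately have "ratio * F (z r) + g \<le> ratio * gz" by (simp add: distrib_left)
      then have "pot z x2 \<rho>2 + move_cost l w x x2 + (F (x1 r) + d + g) \<le> pot z x \<rho> + \<delta> + ratio * gz"
        using p1[OF z] p2[of z] move_cost_triangle[of x x2 x1] d K\<theta> by linarith
      then have le: "ereal (pot z x2 \<rho>2 + move_cost l w x x2) + ereal (F (x1 r) + d + g)
          \<le> ereal (pot z x \<rho> + \<delta>) + ereal ratio * ereal gz" by simp
      have "ereal (pot z x2 \<rho>2 + move_cost l w x x2) + f (x2 r)
          \<le> ereal (pot z x2 \<rho>2 + move_cost l w x x2) + ereal (F (x1 r) + d + g)"
        using fx2 by (rule add_left_mono)
      from order_trans[OF this le] show ?thesis unfolding gz .
    qed
  qed (use s2 in simp)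
qed

end

section \<open>The online algorithm and its amortised analysis\<close>

text \<open>If the comparator has paid an infinite cost the claim is trivial; otherwise the two
  premises force the costs of the algorithm to be finite too, and real arithmetic applies.\<close>

lemma ereal_amortised_step:
  assumes "0 \<le> C" "0 \<le> C'" "0 \<le> a" "0 \<le> b" "0 < R"
    and "ereal p + C \<le> ereal R * C' + ereal e"
    and "ereal (p' + m) + a \<le> ereal (p'' + \<delta>) + ereal R * b"
    and "p'' \<le> p + R * m'"
  shows "ereal p' + (C + (ereal m + a)) \<le> ereal R * (C' + (ereal m' + b)) + ereal (e + \<delta>)"
proof (cases "C' = \<infinity> \<or> b = \<infinity>")
  case True
  then have inf: "C' + (ereal m' + b) = \<infinity>" using assms(2,4) by auto
  show ?thesis unfolding inf using assms(5) by simp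
next
  case False
  then obtain c' b' where r: "C' = ereal c'" "b = ereal b'" using assms(2,4) by (cases C'; cases b) auto
  obtain c a' where r': "C = ereal c" "a = ereal a'" using assms(1,3,6,7) r by (cases C; cases a) auto
  show ?thesis using assms(6-8) unfolding r r' by (simp add: algebra_simps)
qed

context weighted_allocation
begin

text \<open>The choice depends only on the tolerance, the request and the current state, which makes
  the resulting algorithm online; the guarantee holds for all z at once, so no comparator is fixed
  in advance.\<close>

definition serve :: "real \<Rightarrow> request \<Rightarrow> (nat \<Rightarrow> real) \<times> (nat \<Rightarrow> real) \<Rightarrow> (nat \<Rightarrow> real) \<times> (nat \<Rightarrow> real)" where
  "serve \<delta> q s = (SOME s'. state (fst s') (snd s') \<and> (\<forall>z\<in>simplex l.
     ereal (pot z (fst s') (snd s') + move_cost l w (fst s) (fst s')) + snd q (fst s' (fst q))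
       \<le> ereal (pot z (fst s) (snd s) + \<delta>) + ereal ratio * snd q (z (fst q))))"

lemma serve:
  assumes "state (fst s) (snd s)" "valid_request l q" "0 < \<delta>"
  shows "state (fst (serve \<delta> q s)) (snd (serve \<delta> q s))"
    and "z \<in> simplex l \<Longrightarrow>
     ereal (pot z (fst (serve \<delta> q s)) (snd (serve \<delta> q s)) + move_cost l w (fst s) (fst (serve \<delta> q s)))
         + snd q (fst (serve \<delta> q s) (fst q))
       \<le> ereal (pot z (fst s) (snd s) + \<delta>) + ereal ratio * snd q (z (fst q))"
proof -
  have "\<exists>s'. state (fst s') (snd s') \<and> (\<forall>z\<in>simplex l.
     ereal (pot z (fst s') (snd s') + move_cost l w (fst s) (fst s')) + snd q (fst s' (fst q))
       \<le> ereal (pot z (fst s) (snd s) + \<delta>) + ereal ratio * snd q (z (fst q)))"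
    using serve_request[OF assms(1), of "fst q" "snd q" \<delta>] assms(2,3) by auto
  from someI_ex[OF this, folded serve_def]
  show "state (fst (serve \<delta> q s)) (snd (serve \<delta> q s))"
    and "z \<in> simplex l \<Longrightarrow>
     ereal (pot z (fst (serve \<delta> q s)) (snd (serve \<delta> q s)) + move_cost l w (fst s) (fst (serve \<delta> q s)))
         + snd q (fst (serve \<delta> q s) (fst q))
       \<le> ereal (pot z (fst s) (snd s) + \<delta>) + ereal ratio * snd q (z (fst q))"
    by auto
qed

text \<open>The requests are listed most recent first.\<close>

primrec run :: "(nat \<Rightarrow> real) \<Rightarrow> request list \<Rightarrow> (nat \<Rightarrow> real) \<times> (nat \<Rightarrow> real)" where
  "run x0 [] = (x0, x0)"
| "run x0 (q # qs) = serve ((1 / 2) ^ length qs) q (run x0 qs)"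

definition alg :: "(nat \<Rightarrow> real) \<Rightarrow> request list \<Rightarrow> nat \<Rightarrow> real" where
  "alg x0 qs = fst (run x0 (rev qs))"

lemma state_run:
  assumes "x0 \<in> simplex l" "list_all (valid_request l) qs"
  shows "state (fst (run x0 qs)) (snd (run x0 qs))"
  using assms(2)
proof (induction qs)
  case Nil
  then show ?case using assms(1) by (simp add: state_def)
next
  case (Cons q qs)
  then show ?case using serve(1)[of "run x0 qs" q "(1 / 2) ^ length qs"] by simp
qed

lemma online_alg_alg: "x0 \<in> simplex l \<Longrightarrow> online_alg l (alg x0)"
  unfolding online_alg_def alg_def using state_run[of x0 "rev _"] by (auto simp: state_def)

lemma move_cost_nonneg: "0 \<le> move_cost l w x y"
  unfolding move_cost_def using w_pos by (intro sum_nonneg mult_nonneg_nonneg) (auto intro: less_imp_le)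

lemma request_cost_nonneg:
  assumes "valid_request l q" "x \<in> simplex l"
  shows "0 \<le> snd q (x (fst q))"
  using assms simplex_nonneg simplex_le_1 by (auto simp: valid_request_def convex_cost_def)

text \<open>In each round the comparator moves first, at the Lipschitz rate of the potential, and
  then the algorithm serves. The tolerances are powers of 1/2, so their sum stays below 2 for every
  number of requests.\<close>

lemma total_cost_alg:
  assumes x0: "x0 \<in> simplex l" and qs: "list_all (valid_request l) qs"
    and X: "X 0 = x0" "\<And>t. t \<in> {1..length qs} \<Longrightarrow> X t \<in> simplex l"
  shows "total_cost l w qs (alg_traj x0 (alg x0) qs) \<le> ereal ratio * total_cost l w qs X + ereal 2"
proof -
  define s where "s t = run x0 (rev (take t qs))" for t
  define Y where "Y = alg_traj x0 (alg x0) qs"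
  define ac where "ac t = snd (qs ! t) (Y (Suc t) (fst (qs ! t)))" for t
  define oc where "oc t = snd (qs ! t) (X (Suc t) (fst (qs ! t)))" for t
  have Y: "Y t = fst (s t)" for t by (simp add: Y_def alg_traj_def s_def alg_def)
  have st: "state (fst (s t)) (snd (s t))" for t
    unfolding s_def using qs by (intro state_run[OF x0]) (auto simp: list_all_iff dest: in_set_takeD)
  have req: "valid_request l (qs ! t)" if "t < length qs" for t using qs that by (simp add: list_all_length)
  have nonneg: "0 \<le> ac t" "0 \<le> oc t" if "t < length qs" for t
    using request_cost_nonneg[OF req[OF that]] st[of "Suc t"] X(2)[of "Suc t"] that
    by (auto simp: ac_def oc_def Y state_def)
  have "ereal (pot (X n) (fst (s n)) (snd (s n))) + (\<Sum>t<n. ereal (move_cost l w (Y t) (Y (Suc t))) + ac t)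
      \<le> ereal ratio * (\<Sum>t<n. ereal (move_cost l w (X t) (X (Suc t))) + oc t) + ereal (\<Sum>t<n. (1 / 2) ^ t)"
    if "n \<le> length qs" for n
    using that
  proof (induction n)
    case 0
    \<comment> \<open>The reference point starts at x0, where the comparator also starts, so all
      three terms vanish and the additive constant does not depend on the weights.\<close>
    have "pot (X 0) (fst (s 0)) (snd (s 0)) = 0" by (simp add: s_def X pot_def coord_pot_def)
    then show ?case by simp
  next
    case (Suc n)
    then have n: "n < length qs" by simp
    have s: "s (Suc n) = serve ((1 / 2) ^ n) (qs ! n) (s n)"
      using n by (simp add: s_def take_Suc_conv_app_nth)
    have "X (Suc n) \<in> simplex l" using X n by simp
    from serve(2)[OF st req[OF n] _ this, of "(1 / 2) ^ n" n, folded s, folded Y]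
    have "ereal (pot (X (Suc n)) (Y (Suc n)) (snd (s (Suc n))) + move_cost l w (Y n) (Y (Suc n))) + ac n
      \<le> ereal (pot (X (Suc n)) (Y n) (snd (s n)) + (1 / 2) ^ n) + ereal ratio * oc n"
      by (simp add: ac_def oc_def)
    moreover have "pot (X (Suc n)) (Y n) (snd (s n)) \<le> pot (X n) (Y n) (snd (s n)) + ratio * move_cost l w (X n) (X (Suc n))"
      unfolding Y by (rule pot_Lipschitz[OF st])
    moreover have "0 \<le> (\<Sum>t<n. ereal (move_cost l w (Y t) (Y (Suc t))) + ac t)"
      "0 \<le> (\<Sum>t<n. ereal (move_cost l w (X t) (X (Suc t))) + oc t)"
      using n by (auto intro!: sum_nonneg add_nonneg_nonneg nonneg move_cost_nonneg)
    ultimately show ?case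
      using ereal_amortised_step[OF _ _ nonneg[OF n] ratio_pos] Suc.IH n
      unfolding sum.lessThan_Suc Y[symmetric] by simp
  qed
  from this[of "length qs"]
  have 1: "ereal (pot (X (length qs)) (fst (s (length qs))) (snd (s (length qs)))) + total_cost l w qs Y
     \<le> ereal ratio * total_cost l w qs X + ereal (\<Sum>t<length qs. (1 / 2) ^ t)"
    by (simp add: total_cost_def ac_def oc_def)
  have "(\<Sum>t<length qs. (1 / 2) ^ t) \<le> (2 :: real)"
    by (subst sum_gp_strict) simp
  then have 2: "ereal ratio * total_cost l w qs X + ereal (\<Sum>t<length qs. (1 / 2) ^ t) \<le> ereal ratio * total_cost l w qs X + ereal 2"
    by (intro add_left_mono) simp
  have "0 + total_cost l w qs Y \<le> ereal (pot (X (length qs)) (fst (s (length qs))) (snd (s (length qs)))) + total_cost l w qs Y"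
    using pot_nonneg[OF st] by (intro add_right_mono) simp
  then show ?thesis using 1 2 by (simp add: Y_def)
qed

lemma alg_competitive:
  assumes x0: "x0 \<in> simplex l" and qs: "list_all (valid_request l) qs"
  shows "total_cost l w qs (alg_traj x0 (alg x0) qs) \<le> ereal ratio * OPT l w x0 qs + ereal 2"
proof -
  let ?A = "total_cost l w qs (alg_traj x0 (alg x0) qs)"
  \<comment> \<open>The infimum is not assumed to be attained; solving for the cost of X gives a
    lower bound common to all trajectories.\<close>
  have "(?A - ereal 2) / ereal ratio \<le> OPT l w x0 qs"
    unfolding OPT_def
  proof (rule INF_greatest)
    fix X assume "X \<in> {X. X 0 = x0 \<and> (\<forall>t\<in>{1..length qs}. X t \<in> simplex l)}"
    then have "?A \<le> ereal ratio * total_cost l w qs X + ereal 2"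
      using total_cost_alg[OF x0 qs, of X] by simp
    then have "?A - ereal 2 \<le> ereal ratio * total_cost l w qs X" by (simp add: ereal_minus_le)
    then show "(?A - ereal 2) / ereal ratio \<le> total_cost l w qs X"
      using ratio_pos by (simp add: ereal_divide_le_pos)
  qed
  then have "?A - ereal 2 \<le> ereal ratio * OPT l w x0 qs"
    using ratio_pos by (simp add: ereal_divide_le_pos)
  then show ?thesis by (simp add: ereal_minus_le)
qed

lemma OPT_nonneg:
  assumes "list_all (valid_request l) qs"
  shows "0 \<le> OPT l w x0 qs"
  unfolding OPT_def total_cost_def
proof (intro INF_greatest sum_nonneg add_nonneg_nonneg)
  fix X t assume "X \<in> {X. X 0 = x0 \<and> (\<forall>t\<in>{1..length qs}. X t \<in> simplex l)}" "t \<in> {..<length qs}"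
  then show "0 \<le> snd (qs ! t) (X (Suc t) (fst (qs ! t)))"
    using assms by (intro request_cost_nonneg) (auto simp: list_all_length)
qed (simp add: move_cost_nonneg)

text \<open>Since e \<le> 3 \<le> l + 1, the summand 1 is itself at most ln (l + 1), which doubles
  the constant.\<close>

lemma ratio_le: "ratio \<le> 6400 * ln (real l + 1)"
proof -
  have "ln (real l) \<le> ln (real l + 1)" using l2 by simp
  moreover have "1 \<le> ln (real l + 1)"
  proof -
    have "exp 1 \<le> real l + 1" using exp_le l2 by simp
    then show ?thesis using l2 by (simp add: ln_ge_iff)
  qed
  ultimately show ?thesis by (simp add: ratio_def)
qed

end

theorem theorem4:
  shows "\<exists>c>0. \<forall>l::nat. l \<ge> 2 \<longrightarrow>
    (\<forall>w::nat \<Rightarrow> real. (\<forall>i<l. 0 < w i) \<longrightarrow>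
      (\<forall>x0 \<in> simplex l. \<exists>A. online_alg l A \<and>
         (\<exists>b::real. \<forall>qs. list_all (valid_request l) qs \<longrightarrow>
            total_cost l w qs (alg_traj x0 A qs)
              \<le> ereal (c * ln (real l + 1)) * OPT l w x0 qs + ereal b)))"
proof (intro exI[of _ "6400 :: real"] conjI allI impI ballI)
  fix l :: nat and w x0 :: "nat \<Rightarrow> real"
  assume l: "2 \<le> l" and w: "\<forall>i<l. 0 < w i" and x0: "x0 \<in> simplex l"
  interpret weighted_allocation l w using l w by unfold_locales auto
  have "total_cost l w qs (alg_traj x0 (alg x0) qs) \<le> ereal (6400 * ln (real l + 1)) * OPT l w x0 qs + ereal 2"
    if qs: "list_all (valid_request l) qs" for qs
  proof -
    have "ereal ratio * OPT l w x0 qs \<le> ereal (6400 * ln (real l + 1)) * OPT l w x0 qs"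
      using ratio_le OPT_nonneg[OF qs] by (intro ereal_mult_right_mono) auto
    then show ?thesis using alg_competitive[OF x0 qs] add_right_mono order_trans by blast
  qed
  then show "\<exists>A. online_alg l A \<and> (\<exists>b::real. \<forall>qs. list_all (valid_request l) qs \<longrightarrow>
            total_cost l w qs (alg_traj x0 A qs) \<le> ereal (6400 * ln (real l + 1)) * OPT l w x0 qs + ereal b)"
    using online_alg_alg[OF x0] by blast
qed simp

end
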